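(* Let $(A,\mu,\alpha,\beta)$ be a BiHom-associative algebra over a field $k$, with $\mu(x\otimes y)=xy$, let $\lambda\in k$, and let $R:A\to A$ be a Rota-Baxter operator of weight $\lambda$ for $(A,\mu)$ such that $R\circ\alpha=\alpha\circ R$ and $R\circ\beta=\beta\circ R$. Then the linear map $T:A\otimes A\to A\otimes A$, $$T(a\otimes b)=R(a)\otimes b+a\otimes R(b)+\lambda a\otimes b\quad(a,b\in A),$$ is a weak BiHom-pseudotwistor for $A$ with weak companion $\mathcal{T}:A\otimes A\otimes A\to A\otimes A\otimes A$, $$\mathcal{T}(a\otimes b\otimes c)=R(a)\otimes R(b)\otimes c+R(a)\otimes b\otimes R(c)+a\otimes R(b)\otimes R(c)+\lambda R(a)\otimes b\otimes c+\lambda a\otimes R(b)\otimes c+\lambda a\otimes b\otimes R(c)+\lambda^2a\otimes b\otimes c,$$ and the new BiHom-associative multiplication $\mu\circ T$ on $A$ (that is, $(A,\mu\circ T,\alpha,\beta)$ is a BiHom-associative algebra) is given by $a*b=R(a)b+aR(b)+\lambda ab$.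
   Context: Everything is over a fixed field $k$; no unit is assumed. A BiHom-associative algebra is a 4-tuple $(A,\mu,\alpha,\beta)$ with $A$ a linear space, $\alpha,\beta:A\to A$ and $\mu:A\otimes A\to A$, $\mu(x\otimes y)=xy$, linear maps such that for all $x,y,z\in A$: $\alpha\circ\beta=\beta\circ\alpha$; $\alpha(xy)=\alpha(x)\alpha(y)$; $\beta(xy)=\beta(x)\beta(y)$; $\alpha(x)(yz)=(xy)\beta(z)$. A Rota-Baxter operator of weight $\lambda\in k$ for $(A,\mu)$ is a linear map $R:A\to A$ with $R(x)R(y)=R(R(x)y+xR(y)+\lambda xy)$ for all $x,y\in A$. A weak BiHom-pseudotwistor for a BiHom-associative algebra $(A,\mu,\alpha,\beta)$, with weak companion $\mathcal{T}$, is a linear map $T:A\otimes A\to A\otimes A$ commuting with $\alpha\otimes\alpha$ and $\beta\otimes\beta$, where $\mathcal{T}:A\otimes A\otimes A\to A\otimes A\otimes A$ is a linear map such that $T\circ(\alpha\otimes(\mu\circ T))=(\alpha\otimes\mu)\circ\mathcal{T}$ and $T\circ((\mu\circ T)\otimes\beta)=(\mu\otimes\beta)\circ\mathcal{T}$. *)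

theory Defs
  imports "HOL-Algebra.AbelCoset" "Jordan_Normal_Form.Missing_VectorSpace"
begin

section \<open>The tensor product of two vector spaces\<close>

text \<open>The free vector space on \<open>X\<close>, as the finitely supported functions inside
  the space \<^term>\<open>ring.func_space K X\<close> of all functions from \<open>X\<close> to \<open>K\<close>.\<close>

definition free_space ::
  "('k, 'm) ring_scheme \<Rightarrow> 'x set \<Rightarrow> ('k, 'x \<Rightarrow> 'k) module" where
  "free_space K X = (ring.func_space K X)
     \<lparr>carrier := {f \<in> X \<rightarrow>\<^sub>E carrier K. finite {x \<in> X. f x \<noteq> \<zero>\<^bsub>K\<^esub>}}\<rparr>"

definition free_unit :: "('k, 'm) ring_scheme \<Rightarrow> 'x set \<Rightarrow> 'x \<Rightarrow> 'x \<Rightarrow> 'k" where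
  "free_unit K X x = (\<lambda>y\<in>X. if y = x then \<one>\<^bsub>K\<^esub> else \<zero>\<^bsub>K\<^esub>)"

text \<open>The quotient of a vector space by a subspace \<open>W\<close>. Its elements are the cosets of \<open>W\<close>;
  the unused ring fields \<open>mult\<close> and \<open>one\<close> carry no meaning.\<close>

definition quotient_space ::
  "('k, 'v, 'n) module_scheme \<Rightarrow> 'v set \<Rightarrow> ('k, 'v set) module" where
  "quotient_space V W =
     \<lparr>carrier = a_rcosets\<^bsub>V\<^esub> W, mult = (\<lambda>_ _. W), one = W, zero = W, add = set_add V,
      smult = (\<lambda>c C. \<Union>v\<in>C. W +>\<^bsub>V\<^esub> (c \<odot>\<^bsub>V\<^esub> v))\<rparr>"

definition tensor_relators ::
  "('k, 'm) ring_scheme \<Rightarrow> ('k, 'a, 'n) module_scheme \<Rightarrow> ('k, 'b, 'p) module_scheme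
   \<Rightarrow> ('a \<times> 'b \<Rightarrow> 'k) set" where
  "tensor_relators K M N =
    (let F = free_space K (carrier M \<times> carrier N);
         e = free_unit K (carrier M \<times> carrier N)
     in {e (a \<oplus>\<^bsub>M\<^esub> a', b) \<ominus>\<^bsub>F\<^esub> (e (a, b) \<oplus>\<^bsub>F\<^esub> e (a', b)) | a a' b.
            a \<in> carrier M \<and> a' \<in> carrier M \<and> b \<in> carrier N}
      \<union> {e (a, b \<oplus>\<^bsub>N\<^esub> b') \<ominus>\<^bsub>F\<^esub> (e (a, b) \<oplus>\<^bsub>F\<^esub> e (a, b')) | a b b'.
            a \<in> carrier M \<and> b \<in> carrier N \<and> b' \<in> carrier N}
      \<union> {e (c \<odot>\<^bsub>M\<^esub> a, b) \<ominus>\<^bsub>F\<^esub> c \<odot>\<^bsub>F\<^esub> e (a, b) | c a b.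
            c \<in> carrier K \<and> a \<in> carrier M \<and> b \<in> carrier N}
      \<union> {e (a, c \<odot>\<^bsub>N\<^esub> b) \<ominus>\<^bsub>F\<^esub> c \<odot>\<^bsub>F\<^esub> e (a, b) | c a b.
            c \<in> carrier K \<and> a \<in> carrier M \<and> b \<in> carrier N})"

definition tensor_null ::
  "('k, 'm) ring_scheme \<Rightarrow> ('k, 'a, 'n) module_scheme \<Rightarrow> ('k, 'b, 'p) module_scheme
   \<Rightarrow> ('a \<times> 'b \<Rightarrow> 'k) set" where
  "tensor_null K M N =
     module.span K (free_space K (carrier M \<times> carrier N)) (tensor_relators K M N)"

definition tensor_space ::
  "('k, 'm) ring_scheme \<Rightarrow> ('k, 'a, 'n) module_scheme \<Rightarrow> ('k, 'b, 'p) module_scheme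
   \<Rightarrow> ('k, ('a \<times> 'b \<Rightarrow> 'k) set) module" where
  "tensor_space K M N =
     quotient_space (free_space K (carrier M \<times> carrier N)) (tensor_null K M N)"

definition tensor_elt ::
  "('k, 'm) ring_scheme \<Rightarrow> ('k, 'a, 'n) module_scheme \<Rightarrow> ('k, 'b, 'p) module_scheme
   \<Rightarrow> 'a \<Rightarrow> 'b \<Rightarrow> ('a \<times> 'b \<Rightarrow> 'k) set" where
  "tensor_elt K M N a b =
     tensor_null K M N +>\<^bsub>free_space K (carrier M \<times> carrier N)\<^esub>
       free_unit K (carrier M \<times> carrier N) (a, b)"

text \<open>The map on the tensor product induced by a bilinear map \<open>\<phi>\<close> into \<open>P\<close>: the linear
  extension of \<open>\<phi>\<close> to the free space is constant on each coset, and its value there is taken.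
  Linearity and the value \<open>\<phi> a b\<close> at \<open>a \<otimes> b\<close> are proved below for bilinear \<open>\<phi>\<close>.\<close>

definition tensor_lift ::
  "('k, 'm) ring_scheme \<Rightarrow> ('k, 'a, 'n) module_scheme \<Rightarrow> ('k, 'b, 'p) module_scheme
   \<Rightarrow> ('k, 'c, 'q) module_scheme \<Rightarrow> ('a \<Rightarrow> 'b \<Rightarrow> 'c) \<Rightarrow> ('a \<times> 'b \<Rightarrow> 'k) set \<Rightarrow> 'c" where
  "tensor_lift K M N P \<phi> C =
     the_elem ((\<lambda>f. \<Oplus>\<^bsub>P\<^esub>x\<in>{x \<in> carrier M \<times> carrier N. f x \<noteq> \<zero>\<^bsub>K\<^esub>}.
                     f x \<odot>\<^bsub>P\<^esub> \<phi> (fst x) (snd x)) ` C)"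

subsection \<open>Universal property\<close>

lemma free_space_submodule:
  assumes "field K"
  shows "submodule K (carrier (free_space K X)) (ring.func_space K X)"
proof -
  interpret K: field K by fact
  have m: "module K (K.func_space X)" by (rule K.func_space_is_module)
  have fin: "finite {x \<in> X. (\<lambda>v\<in>X. f v \<oplus>\<^bsub>K\<^esub> g v) x \<noteq> \<zero>\<^bsub>K\<^esub>}"
    if "finite {x \<in> X. f x \<noteq> \<zero>\<^bsub>K\<^esub>}" "finite {x \<in> X. g x \<noteq> \<zero>\<^bsub>K\<^esub>}" for f g
    by (rule finite_subset[of _ "{x \<in> X. f x \<noteq> \<zero>\<^bsub>K\<^esub>} \<union> {x \<in> X. g x \<noteq> \<zero>\<^bsub>K\<^esub>}"])
       (use that in auto)
  have fin2: "finite {x \<in> X. (\<lambda>v\<in>X. c \<otimes>\<^bsub>K\<^esub> f v) x \<noteq> \<zero>\<^bsub>K\<^esub>}"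
    if "finite {x \<in> X. f x \<noteq> \<zero>\<^bsub>K\<^esub>}" "c \<in> carrier K" for f c
    by (rule finite_subset[OF _ that(1)]) (use that in auto)
  show ?thesis
  proof (rule submodule.intro[OF m])
    show "carrier (free_space K X) \<subseteq> carrier (K.func_space X)"
      by (auto simp: free_space_def K.func_space_def)
    show "\<zero>\<^bsub>K.func_space X\<^esub> \<in> carrier (free_space K X)"
      by (auto simp: free_space_def K.func_space_def)
    fix f g assume fg: "f \<in> carrier (free_space K X)" "g \<in> carrier (free_space K X)"
    have "(\<lambda>v\<in>X. f v \<oplus>\<^bsub>K\<^esub> g v) \<in> X \<rightarrow>\<^sub>E carrier K" using fg by (auto simp: free_space_def)
    then show "f \<oplus>\<^bsub>K.func_space X\<^esub> g \<in> carrier (free_space K X)"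
      using fg fin[of f g] by (simp add: free_space_def K.func_space_def)
  next
    fix c f assume fg: "c \<in> carrier K" "f \<in> carrier (free_space K X)" 
    have "(\<lambda>v\<in>X. c \<otimes>\<^bsub>K\<^esub> f v) \<in> X \<rightarrow>\<^sub>E carrier K" using fg by (auto simp: free_space_def)
    then show "c \<odot>\<^bsub>K.func_space X\<^esub> f \<in> carrier (free_space K X)"
      using fg fin2[of f c] by (simp add: free_space_def K.func_space_def)
  qed
qed

lemma free_space_vectorspace:
  assumes "field K" shows "vectorspace K (free_space K X)"
proof -
  interpret K: field K by fact
  interpret m: module K "K.func_space X" by (rule K.func_space_is_module)
  have "module K (free_space K X)"
    using m.submodule_is_module[OF free_space_submodule[OF assms]] by (simp add: free_space_def)
  then show ?thesis by (simp add: vectorspace_def assms)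
qed

lemma free_space_simps:
  assumes "field K"
  shows "f \<oplus>\<^bsub>free_space K X\<^esub> g = (\<lambda>v\<in>X. f v \<oplus>\<^bsub>K\<^esub> g v)"
    "c \<odot>\<^bsub>free_space K X\<^esub> g = (\<lambda>v\<in>X. c \<otimes>\<^bsub>K\<^esub> g v)"
    "\<zero>\<^bsub>free_space K X\<^esub> = (\<lambda>v\<in>X. \<zero>\<^bsub>K\<^esub>)"
    "carrier (free_space K X) = {f \<in> X \<rightarrow>\<^sub>E carrier K. finite {x \<in> X. f x \<noteq> \<zero>\<^bsub>K\<^esub>}}"
proof -
  interpret K: field K by fact
  show "f \<oplus>\<^bsub>free_space K X\<^esub> g = (\<lambda>v\<in>X. f v \<oplus>\<^bsub>K\<^esub> g v)"
    "c \<odot>\<^bsub>free_space K X\<^esub> g = (\<lambda>v\<in>X. c \<otimes>\<^bsub>K\<^esub> g v)"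
    "\<zero>\<^bsub>free_space K X\<^esub> = (\<lambda>v\<in>X. \<zero>\<^bsub>K\<^esub>)"
    "carrier (free_space K X) = {f \<in> X \<rightarrow>\<^sub>E carrier K. finite {x \<in> X. f x \<noteq> \<zero>\<^bsub>K\<^esub>}}"
    by (simp_all add: free_space_def K.func_space_def)
qed

lemma free_unit_closed:
  assumes "field K" "x \<in> X" shows "free_unit K X x \<in> carrier (free_space K X)"
proof -
  interpret K: field K by fact
  have "finite {y \<in> X. free_unit K X x y \<noteq> \<zero>\<^bsub>K\<^esub>}"
    by (rule finite_subset[of _ "{x}"]) (auto simp: free_unit_def)
  then show ?thesis by (auto simp: free_space_simps[OF assms(1)] free_unit_def)
qed

locale quotient_by_subspace = vectorspace K V for K and V (structure) + fixes W assumes W: "subspace K W V"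
begin
lemma subm: "submodule K W V" using W by (simp add: subspace_def)
lemma Wsub: "W \<subseteq> carrier V" using subm by (simp add: submodule_def)
lemma Wsm: "c \<in> carrier K \<Longrightarrow> v \<in> W \<Longrightarrow> c \<odot> v \<in> W" using subm by (simp add: submodule_def)
lemma Wadd: "u \<in> W \<Longrightarrow> v \<in> W \<Longrightarrow> u \<oplus> v \<in> W" using subm by (simp add: submodule_def)
lemma W0: "\<zero> \<in> W" using subm by (simp add: submodule_def)
lemma ag: "additive_subgroup W V"
proof
  show "W \<subseteq> carrier (add_monoid V)" using Wsub by simp
  show "x \<otimes>\<^bsub>add_monoid V\<^esub> y \<in> W" if "x \<in> W" "y \<in> W" for x y using that Wadd by simp
  show "\<one>\<^bsub>add_monoid V\<^esub> \<in> W" using W0 by simp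
  show "inv\<^bsub>add_monoid V\<^esub> x \<in> W" if "x \<in> W" for x
  proof -
    have "\<ominus>\<^bsub>V\<^esub> x = (\<ominus>\<^bsub>K\<^esub> \<one>\<^bsub>K\<^esub>) \<odot> x" using that Wsub smult_l_minus[of "\<one>\<^bsub>K\<^esub>" x] by auto
    then show ?thesis using that Wsm[of "\<ominus>\<^bsub>K\<^esub> \<one>\<^bsub>K\<^esub>" x] by (simp add: a_inv_def)
  qed
qed
sublocale as: abelian_subgroup W V
  by (rule abelian_subgroupI3[OF ag]) (rule M.abelian_group_axioms)

abbreviation "Q \<equiv> quotient_space V W"

lemma cosetE: assumes "C \<in> carrier Q" obtains v where "v \<in> carrier V" "C = W +> v"
  using assms by (auto simp: quotient_space_def A_RCOSETS_def')
lemma coset_closed: "v \<in> carrier V \<Longrightarrow> W +> v \<in> carrier Q"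
  by (auto simp: quotient_space_def A_RCOSETS_def')
lemma coset_add: "u \<in> carrier V \<Longrightarrow> v \<in> carrier V \<Longrightarrow> (W +> u) \<oplus>\<^bsub>Q\<^esub> (W +> v) = W +> (u \<oplus> v)"
  by (simp add: quotient_space_def as.a_rcos_sum)
lemma coset_zero: "\<zero>\<^bsub>Q\<^esub> = W +> \<zero>" using Wsub by (simp add: quotient_space_def)
lemma coset_eqI: "u \<in> W +> v \<Longrightarrow> v \<in> carrier V \<Longrightarrow> W +> u = W +> v"
  by (rule M.a_repr_independence[OF _ _ as.a_subgroup, symmetric])
lemma coset_smult: assumes "c \<in> carrier K" "v \<in> carrier V"
  shows "c \<odot>\<^bsub>Q\<^esub> (W +> v) = W +> (c \<odot> v)"
proof -
  have "W +> (c \<odot> u) = W +> (c \<odot> v)" if u: "u \<in> W +> v" for u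
  proof (rule coset_eqI)
    obtain w where w: "w \<in> W" "u = w \<oplus> v" using u by (auto simp: a_r_coset_def')
    then have "c \<odot> u = c \<odot> w \<oplus> c \<odot> v" using assms Wsub by (auto simp: smult_r_distr)
    then show "c \<odot> u \<in> W +> (c \<odot> v)" using Wsm[OF assms(1) w(1)] by (auto simp: a_r_coset_def')
  qed (use assms in simp)
  note * = this
  have ne: "v \<in> W +> v" using as.a_rcos_self assms by simp
  have "c \<odot>\<^bsub>Q\<^esub> (W +> v) = (\<Union>u\<in>W +> v. W +> (c \<odot> u))" by (simp add: quotient_space_def)
  also have "\<dots> = (\<Union>u\<in>W +> v. W +> (c \<odot> v))" by (rule SUP_cong[OF refl *])
  also have "\<dots> = W +> (c \<odot> v)" using ne by blast
  finally show ?thesis .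
qed

lemma quot_vs: "vectorspace K Q"
proof -
  have "module K Q"
  proof (rule module_criteria)
    show "cring K" by (rule R.cring_axioms)
    show "\<forall>v\<in>carrier Q. \<exists>n\<in>carrier Q. v \<oplus>\<^bsub>Q\<^esub> n = \<zero>\<^bsub>Q\<^esub>"
    proof
      fix v assume "v \<in> carrier Q"
      then obtain x where x: "x \<in> carrier V" "v = W +> x" by (rule cosetE)
      show "\<exists>n\<in>carrier Q. v \<oplus>\<^bsub>Q\<^esub> n = \<zero>\<^bsub>Q\<^esub>"
        by (rule bexI[of _ "W +> (\<ominus> x)"]) (use x in \<open>auto simp: coset_add coset_zero coset_closed M.r_neg\<close>)
    qed
    note simps = coset_add coset_smult coset_zero coset_closed
    show "\<zero>\<^bsub>Q\<^esub> \<in> carrier Q" by (simp add: simps)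
    show "\<forall>v w. v \<in> carrier Q \<and> w \<in> carrier Q \<longrightarrow> v \<oplus>\<^bsub>Q\<^esub> w \<in> carrier Q"
      by (intro allI impI, elim conjE cosetE, simp add: simps)
    show "\<forall>v w. v \<in> carrier Q \<and> w \<in> carrier Q \<longrightarrow> v \<oplus>\<^bsub>Q\<^esub> w = w \<oplus>\<^bsub>Q\<^esub> v"
      by (intro allI impI, elim conjE cosetE, simp add: simps M.a_comm)
    show "\<forall>v w x. v \<in> carrier Q \<and> w \<in> carrier Q \<and> x \<in> carrier Q \<longrightarrow> (v \<oplus>\<^bsub>Q\<^esub> w) \<oplus>\<^bsub>Q\<^esub> x = v \<oplus>\<^bsub>Q\<^esub> (w \<oplus>\<^bsub>Q\<^esub> x)"
      by (intro allI impI, elim conjE cosetE, simp add: simps M.a_assoc)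
    show "\<forall>c v. c \<in> carrier K \<and> v \<in> carrier Q \<longrightarrow> c \<odot>\<^bsub>Q\<^esub> v \<in> carrier Q"
      by (intro allI impI, elim conjE cosetE, simp add: simps)
    show "\<forall>v\<in>carrier Q. v \<oplus>\<^bsub>Q\<^esub> \<zero>\<^bsub>Q\<^esub> = v"
      by (intro ballI, elim conjE cosetE, simp add: simps)
    show "\<forall>v\<in>carrier Q. \<one>\<^bsub>K\<^esub> \<odot>\<^bsub>Q\<^esub> v = v"
      by (intro ballI, elim conjE cosetE, simp add: simps)
    show "\<forall>a b v. a \<in> carrier K \<and> b \<in> carrier K \<and> v \<in> carrier Q \<longrightarrow> (a \<otimes>\<^bsub>K\<^esub> b) \<odot>\<^bsub>Q\<^esub> v = a \<odot>\<^bsub>Q\<^esub> (b \<odot>\<^bsub>Q\<^esub> v)"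
      by (intro allI impI, elim conjE cosetE, simp add: simps smult_assoc1)
    show "\<forall>a b v. a \<in> carrier K \<and> b \<in> carrier K \<and> v \<in> carrier Q \<longrightarrow> (a \<oplus>\<^bsub>K\<^esub> b) \<odot>\<^bsub>Q\<^esub> v = a \<odot>\<^bsub>Q\<^esub> v \<oplus>\<^bsub>Q\<^esub> b \<odot>\<^bsub>Q\<^esub> v"
      by (intro allI impI, elim conjE cosetE, simp add: simps smult_l_distr)
    show "\<forall>a v w. a \<in> carrier K \<and> v \<in> carrier Q \<and> w \<in> carrier Q \<longrightarrow> a \<odot>\<^bsub>Q\<^esub> (v \<oplus>\<^bsub>Q\<^esub> w) = a \<odot>\<^bsub>Q\<^esub> v \<oplus>\<^bsub>Q\<^esub> a \<odot>\<^bsub>Q\<^esub> w"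
      by (intro allI impI, elim conjE cosetE, simp add: simps smult_r_distr)
  qed
  then show ?thesis by (simp add: vectorspace_def field_axioms)
qed
end

locale vectorspace_pair = M: vectorspace K M + N: vectorspace K N for K and M and N
begin
abbreviation "F \<equiv> free_space K (carrier M \<times> carrier N)"
abbreviation "e \<equiv> free_unit K (carrier M \<times> carrier N)"
abbreviation "W \<equiv> tensor_null K M N"
lemma fld: "field K" ..
sublocale F: vectorspace K F by (rule free_space_vectorspace) (rule fld)
lemma e_closed[simp]: "a \<in> carrier M \<Longrightarrow> b \<in> carrier N \<Longrightarrow> e (a,b) \<in> carrier F"
  by (rule free_unit_closed[OF fld]) auto
lemma rel_closed: "tensor_relators K M N \<subseteq> carrier F"
proof
  fix x assume "x \<in> tensor_relators K M N"
  then consider (1) a a' b where "x = e (a \<oplus>\<^bsub>M\<^esub> a', b) \<ominus>\<^bsub>F\<^esub> (e (a, b) \<oplus>\<^bsub>F\<^esub> e (a', b))" "a \<in> carrier M" "a' \<in> carrier M" "b \<in> carrier N"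
   | (2) a b b' where "x = e (a, b \<oplus>\<^bsub>N\<^esub> b') \<ominus>\<^bsub>F\<^esub> (e (a, b) \<oplus>\<^bsub>F\<^esub> e (a, b'))" "a \<in> carrier M" "b \<in> carrier N" "b' \<in> carrier N"
   | (3) c a b where "x = e (c \<odot>\<^bsub>M\<^esub> a, b) \<ominus>\<^bsub>F\<^esub> c \<odot>\<^bsub>F\<^esub> e (a, b)" "c \<in> carrier K" "a \<in> carrier M" "b \<in> carrier N"
   | (4) c a b where "x = e (a, c \<odot>\<^bsub>N\<^esub> b) \<ominus>\<^bsub>F\<^esub> c \<odot>\<^bsub>F\<^esub> e (a, b)" "c \<in> carrier K" "a \<in> carrier M" "b \<in> carrier N"
    unfolding tensor_relators_def Let_def by blast
  then show "x \<in> carrier F"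
  proof cases
    case 1 then show ?thesis by (simp only: F.M.minus_closed F.M.add.m_closed M.M.add.m_closed e_closed)
  next case 2 then show ?thesis by (simp only: F.M.minus_closed F.M.add.m_closed N.M.add.m_closed e_closed)
  next case 3 then show ?thesis by (simp only: F.M.minus_closed F.smult_closed M.smult_closed e_closed)
  next case 4 then show ?thesis by (simp only: F.M.minus_closed F.smult_closed N.smult_closed e_closed)
  qed
qed
lemma W_sub: "subspace K W F"
  unfolding tensor_null_def by (rule F.span_is_subspace[OF rel_closed])
lemma qq: "quotient_by_subspace K F W" by (intro quotient_by_subspace.intro quotient_by_subspace_axioms.intro F.vectorspace_axioms W_sub)
sublocale q: quotient_by_subspace K F W by (rule qq)

lemma tensor_vs: "vectorspace K (tensor_space K M N)"
  unfolding tensor_space_def by (rule q.quot_vs)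
lemma te: "tensor_elt K M N a b = W +>\<^bsub>F\<^esub> e (a,b)" by (simp add: tensor_elt_def)
lemma te_closed: "a \<in> carrier M \<Longrightarrow> b \<in> carrier N \<Longrightarrow> tensor_elt K M N a b \<in> carrier (tensor_space K M N)"
  by (simp add: te tensor_space_def q.coset_closed)
end

locale bilinear_map = vectorspace_pair K M N + P: vectorspace K P for K M N P +
  fixes \<phi>
  assumes cl: "a \<in> carrier M \<Longrightarrow> b \<in> carrier N \<Longrightarrow> \<phi> a b \<in> carrier P"
  and add1: "a \<in> carrier M \<Longrightarrow> a' \<in> carrier M \<Longrightarrow> b \<in> carrier N \<Longrightarrow> \<phi> (a \<oplus>\<^bsub>M\<^esub> a') b = \<phi> a b \<oplus>\<^bsub>P\<^esub> \<phi> a' b"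
  and add2: "a \<in> carrier M \<Longrightarrow> b \<in> carrier N \<Longrightarrow> b' \<in> carrier N \<Longrightarrow> \<phi> a (b \<oplus>\<^bsub>N\<^esub> b') = \<phi> a b \<oplus>\<^bsub>P\<^esub> \<phi> a b'"
  and sm1: "c \<in> carrier K \<Longrightarrow> a \<in> carrier M \<Longrightarrow> b \<in> carrier N \<Longrightarrow> \<phi> (c \<odot>\<^bsub>M\<^esub> a) b = c \<odot>\<^bsub>P\<^esub> \<phi> a b"
  and sm2: "c \<in> carrier K \<Longrightarrow> a \<in> carrier M \<Longrightarrow> b \<in> carrier N \<Longrightarrow> \<phi> a (c \<odot>\<^bsub>N\<^esub> b) = c \<odot>\<^bsub>P\<^esub> \<phi> a b"
begin
abbreviation "X \<equiv> carrier M \<times> carrier N"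
definition "ext f = (\<Oplus>\<^bsub>P\<^esub>x\<in>{x \<in> X. f x \<noteq> \<zero>\<^bsub>K\<^esub>}. f x \<odot>\<^bsub>P\<^esub> \<phi> (fst x) (snd x))"
abbreviation "\<psi> x \<equiv> \<phi> (fst x) (snd x)"
lemma pcl: "x \<in> X \<Longrightarrow> \<psi> x \<in> carrier P" by (rule cl) (erule SigmaE, simp)+
lemma tcl: "f \<in> X \<rightarrow> carrier K \<Longrightarrow> x \<in> X \<Longrightarrow> f x \<odot>\<^bsub>P\<^esub> \<psi> x \<in> carrier P"
  by (rule P.smult_closed[OF funcset_mem pcl])
lemma ext_eq: assumes "finite S" "S \<subseteq> X" "\<And>x. x \<in> X \<Longrightarrow> x \<notin> S \<Longrightarrow> f x = \<zero>\<^bsub>K\<^esub>" "f \<in> X \<rightarrow> carrier K"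
  shows "ext f = (\<Oplus>\<^bsub>P\<^esub>x\<in>S. f x \<odot>\<^bsub>P\<^esub> \<psi> x)"
  unfolding ext_def
proof (rule P.M.add.finprod_mono_neutral_cong_left)
  show "finite S" by fact
  show "{x \<in> X. f x \<noteq> \<zero>\<^bsub>K\<^esub>} \<subseteq> S" using assms(3) by blast
  fix i assume i: "i \<in> S - {x \<in> X. f x \<noteq> \<zero>\<^bsub>K\<^esub>}"
  then have "i \<in> X" "f i = \<zero>\<^bsub>K\<^esub>" using assms by blast+
  then show "f i \<odot>\<^bsub>P\<^esub> \<psi> i = \<zero>\<^bsub>P\<^esub>" using P.smult_l_null[OF pcl[of i]] by simp
next
  show "(\<lambda>x. f x \<odot>\<^bsub>P\<^esub> \<psi> x) \<in> S \<rightarrow> carrier P"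
    by (intro Pi_I tcl assms subsetD[OF assms(2)])
qed (rule refl)

lemma ext_lin: "linear_map K F P ext"
proof -
  have FX: "f \<in> X \<rightarrow> carrier K" "finite {x \<in> X. f x \<noteq> \<zero>\<^bsub>K\<^esub>}" if "f \<in> carrier F" for f
    using that by (simp_all add: free_space_simps[OF fld] PiE_def)
  have "ext \<in> module_hom K F P"
    unfolding module_hom_def
  proof (intro CollectI conjI allI impI Pi_I; (elim conjE)?)
    fix f assume f: "f \<in> carrier F"
    show "ext f \<in> carrier P" unfolding ext_def
      by (intro P.M.finsum_closed Pi_I tcl[OF FX(1)[OF f]]) simp
  next
    fix f g assume fg: "f \<in> carrier F" "g \<in> carrier F"
    define S where "S = {x \<in> X. f x \<noteq> \<zero>\<^bsub>K\<^esub>} \<union> {x \<in> X. g x \<noteq> \<zero>\<^bsub>K\<^esub>}"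
    have S: "finite S" "S \<subseteq> X" using FX(2)[OF fg(1)] FX(2)[OF fg(2)] by (simp add: S_def) (simp add: S_def subset_iff)
    note tf = tcl[OF FX(1)[OF fg(1)] subsetD[OF S(2)]] and tg = tcl[OF FX(1)[OF fg(2)] subsetD[OF S(2)]]
    have fgc: "f \<oplus>\<^bsub>F\<^esub> g \<in> X \<rightarrow> carrier K" by (rule FX(1)) (rule F.M.add.m_closed[OF fg])
    have v: "(f \<oplus>\<^bsub>F\<^esub> g) x = f x \<oplus>\<^bsub>K\<^esub> g x" if "x \<in> X" for x using that by (simp add: free_space_simps[OF fld])
    have out: "x \<in> X \<Longrightarrow> x \<notin> S \<Longrightarrow> f x = \<zero>\<^bsub>K\<^esub>" "x \<in> X \<Longrightarrow> x \<notin> S \<Longrightarrow> g x = \<zero>\<^bsub>K\<^esub>" for x by (auto simp: S_def)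
    have "ext (f \<oplus>\<^bsub>F\<^esub> g) = (\<Oplus>\<^bsub>P\<^esub>x\<in>S. (f \<oplus>\<^bsub>F\<^esub> g) x \<odot>\<^bsub>P\<^esub> \<psi> x)"
      by (rule ext_eq[OF S _ fgc]) (simp add: v out)
    also have "\<dots> = (\<Oplus>\<^bsub>P\<^esub>x\<in>S. f x \<odot>\<^bsub>P\<^esub> \<psi> x \<oplus>\<^bsub>P\<^esub> g x \<odot>\<^bsub>P\<^esub> \<psi> x)"
    proof (rule P.M.finsum_cong'[OF refl])
      show "(\<lambda>x. f x \<odot>\<^bsub>P\<^esub> \<psi> x \<oplus>\<^bsub>P\<^esub> g x \<odot>\<^bsub>P\<^esub> \<psi> x) \<in> S \<rightarrow> carrier P"
        by (intro Pi_I P.M.add.m_closed tf tg)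
      fix i assume "i \<in> S"
      then have i: "i \<in> X" using S(2) by blast
      show "(f \<oplus>\<^bsub>F\<^esub> g) i \<odot>\<^bsub>P\<^esub> \<psi> i = f i \<odot>\<^bsub>P\<^esub> \<psi> i \<oplus>\<^bsub>P\<^esub> g i \<odot>\<^bsub>P\<^esub> \<psi> i"
        unfolding v[OF i] by (rule P.smult_l_distr[OF funcset_mem[OF FX(1)[OF fg(1)] i] funcset_mem[OF FX(1)[OF fg(2)] i] pcl[OF i]])
    qed
    also have "\<dots> = (\<Oplus>\<^bsub>P\<^esub>x\<in>S. f x \<odot>\<^bsub>P\<^esub> \<psi> x) \<oplus>\<^bsub>P\<^esub> (\<Oplus>\<^bsub>P\<^esub>x\<in>S. g x \<odot>\<^bsub>P\<^esub> \<psi> x)"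
      by (rule P.M.finsum_addf) (intro Pi_I tf tg, assumption)+
    also have "\<dots> = ext f \<oplus>\<^bsub>P\<^esub> ext g"
      using ext_eq[OF S out(1) FX(1)[OF fg(1)]] ext_eq[OF S out(2) FX(1)[OF fg(2)]] by simp
    finally show "ext (f \<oplus>\<^bsub>F\<^esub> g) = ext f \<oplus>\<^bsub>P\<^esub> ext g" .
  next
    fix c f assume fg: "c \<in> carrier K" "f \<in> carrier F"
    define S where "S = {x \<in> X. f x \<noteq> \<zero>\<^bsub>K\<^esub>}"
    have S: "finite S" "S \<subseteq> X" using FX(2)[OF fg(2)] by (simp add: S_def) (simp add: S_def subset_iff)
    note tf = tcl[OF FX(1)[OF fg(2)] subsetD[OF S(2)]]
    have fgc: "c \<odot>\<^bsub>F\<^esub> f \<in> X \<rightarrow> carrier K" by (rule FX(1)) (rule F.smult_closed[OF fg])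
    have v: "(c \<odot>\<^bsub>F\<^esub> f) x = c \<otimes>\<^bsub>K\<^esub> f x" if "x \<in> X" for x using that by (simp add: free_space_simps[OF fld])
    have out: "x \<in> X \<Longrightarrow> x \<notin> S \<Longrightarrow> f x = \<zero>\<^bsub>K\<^esub>" for x by (auto simp: S_def)
    have "ext (c \<odot>\<^bsub>F\<^esub> f) = (\<Oplus>\<^bsub>P\<^esub>x\<in>S. (c \<odot>\<^bsub>F\<^esub> f) x \<odot>\<^bsub>P\<^esub> \<psi> x)"
      by (rule ext_eq[OF S _ fgc]) (simp add: v out fg)
    also have "\<dots> = (\<Oplus>\<^bsub>P\<^esub>x\<in>S. c \<odot>\<^bsub>P\<^esub> (f x \<odot>\<^bsub>P\<^esub> \<psi> x))"
    proof (rule P.M.finsum_cong'[OF refl])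
      show "(\<lambda>x. c \<odot>\<^bsub>P\<^esub> (f x \<odot>\<^bsub>P\<^esub> \<psi> x)) \<in> S \<rightarrow> carrier P"
        by (intro Pi_I P.smult_closed[OF fg(1)] tf)
      fix i assume "i \<in> S"
      then have i: "i \<in> X" using S(2) by blast
      show "(c \<odot>\<^bsub>F\<^esub> f) i \<odot>\<^bsub>P\<^esub> \<psi> i = c \<odot>\<^bsub>P\<^esub> (f i \<odot>\<^bsub>P\<^esub> \<psi> i)"
        unfolding v[OF i] by (rule P.smult_assoc1[OF fg(1) funcset_mem[OF FX(1)[OF fg(2)] i] pcl[OF i]])
    qed
    also have "\<dots> = c \<odot>\<^bsub>P\<^esub> (\<Oplus>\<^bsub>P\<^esub>x\<in>S. f x \<odot>\<^bsub>P\<^esub> \<psi> x)"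
      by (rule P.finsum_smult[symmetric]) (use fg tf S in \<open>simp_all add: Pi_I\<close>)
    also have "\<dots> = c \<odot>\<^bsub>P\<^esub> ext f"
      using ext_eq[OF S out FX(1)[OF fg(2)]] by simp
    finally show "ext (c \<odot>\<^bsub>F\<^esub> f) = c \<odot>\<^bsub>P\<^esub> ext f" .
  qed
  then show ?thesis
    by (intro linear_map.intro mod_hom.intro F.vectorspace_axioms P.vectorspace_axioms F.module_axioms P.module_axioms mod_hom_axioms.intro)
qed
lemma ext_hom: "ext \<in> module_hom K F P"
  using ext_lin by (simp add: linear_map_def mod_hom_def mod_hom_axioms_def)
lemmas ext_add = module_hom_add[OF ext_hom] and ext_sm = module_hom_smult[OF ext_hom]
lemma ext_cl: "f \<in> carrier F \<Longrightarrow> ext f \<in> carrier P" using module_hom_closed[OF ext_hom] by blast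
definition "kerT = {f \<in> carrier F. ext f = \<zero>\<^bsub>P\<^esub>}"
lemma ext_e: assumes "a \<in> carrier M" "b \<in> carrier N" shows "ext (e (a,b)) = \<phi> a b"
proof -
  have X: "(a,b) \<in> X" using assms by simp
  have ex: "e (a,b) \<in> X \<rightarrow> carrier K" by (simp add: free_unit_def Pi_I)
  have "ext (e (a,b)) = (\<Oplus>\<^bsub>P\<^esub>x\<in>{(a,b)}. e (a,b) x \<odot>\<^bsub>P\<^esub> \<psi> x)"
    by (rule ext_eq[OF _ _ _ ex]) (use X in \<open>auto simp: free_unit_def\<close>)
  also have "\<dots> = (e (a,b) (a,b) \<odot>\<^bsub>P\<^esub> \<phi> a b)"
    using P.M.finsum_insert[of "{}" "(a,b)" "\<lambda>x. e (a,b) x \<odot>\<^bsub>P\<^esub> \<psi> x"] tcl[OF ex X] by simp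
  also have "\<dots> = \<phi> a b" using X P.smult_one[OF cl[OF assms]] by (simp add: free_unit_def)
  finally show ?thesis .
qed

lemma ext_minus: assumes a: "f \<in> carrier F" "g \<in> carrier F" "ext f = ext g" shows "ext (f \<ominus>\<^bsub>F\<^esub> g) = \<zero>\<^bsub>P\<^esub>"
proof -
  have m: "f \<ominus>\<^bsub>F\<^esub> g \<in> carrier F" by (rule F.M.minus_closed[OF a(1,2)])
  have "ext (f \<ominus>\<^bsub>F\<^esub> g) \<oplus>\<^bsub>P\<^esub> ext g = ext ((f \<ominus>\<^bsub>F\<^esub> g) \<oplus>\<^bsub>F\<^esub> g)"
    by (rule ext_add[OF m a(2), symmetric])
  also have "(f \<ominus>\<^bsub>F\<^esub> g) \<oplus>\<^bsub>F\<^esub> g = f"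
    unfolding a_minus_def using a by (simp only: F.M.a_assoc F.M.a_inv_closed F.M.l_neg F.M.r_zero)
  finally have "ext (f \<ominus>\<^bsub>F\<^esub> g) \<oplus>\<^bsub>P\<^esub> ext g = ext g" using a(3) by simp
  then show ?thesis using P.M.add.r_cancel_one[OF ext_cl[OF a(2)] ext_cl[OF m]] by simp
qed

lemma W_ker: "W \<subseteq> kerT"
proof -
  have rk: "tensor_relators K M N \<subseteq> kerT"
  proof
    fix x assume "x \<in> tensor_relators K M N"
    then consider (1) a a' b where "x = e (a \<oplus>\<^bsub>M\<^esub> a', b) \<ominus>\<^bsub>F\<^esub> (e (a, b) \<oplus>\<^bsub>F\<^esub> e (a', b))" "a \<in> carrier M" "a' \<in> carrier M" "b \<in> carrier N"
     | (2) a b b' where "x = e (a, b \<oplus>\<^bsub>N\<^esub> b') \<ominus>\<^bsub>F\<^esub> (e (a, b) \<oplus>\<^bsub>F\<^esub> e (a, b'))" "a \<in> carrier M" "b \<in> carrier N" "b' \<in> carrier N"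
     | (3) c a b where "x = e (c \<odot>\<^bsub>M\<^esub> a, b) \<ominus>\<^bsub>F\<^esub> c \<odot>\<^bsub>F\<^esub> e (a, b)" "c \<in> carrier K" "a \<in> carrier M" "b \<in> carrier N"
     | (4) c a b where "x = e (a, c \<odot>\<^bsub>N\<^esub> b) \<ominus>\<^bsub>F\<^esub> c \<odot>\<^bsub>F\<^esub> e (a, b)" "c \<in> carrier K" "a \<in> carrier M" "b \<in> carrier N"
      unfolding tensor_relators_def Let_def by blast
    then show "x \<in> kerT"
    proof cases
      case 1
      have "ext x = \<zero>\<^bsub>P\<^esub>" unfolding 1 by (rule ext_minus) (use 1 in \<open>simp_all add: ext_e ext_add add1\<close>)
      then show ?thesis using 1 rel_closed \<open>x \<in> tensor_relators K M N\<close> unfolding kerT_def by blast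
    next case 2
      have "ext x = \<zero>\<^bsub>P\<^esub>" unfolding 2 by (rule ext_minus) (use 2 in \<open>simp_all add: ext_e ext_add add2\<close>)
      then show ?thesis using rel_closed \<open>x \<in> tensor_relators K M N\<close> unfolding kerT_def by blast
    next case 3
      have "ext x = \<zero>\<^bsub>P\<^esub>" unfolding 3 by (rule ext_minus) (use 3 in \<open>simp_all add: ext_e ext_sm sm1\<close>)
      then show ?thesis using rel_closed \<open>x \<in> tensor_relators K M N\<close> unfolding kerT_def by blast
    next case 4
      have "ext x = \<zero>\<^bsub>P\<^esub>" unfolding 4 by (rule ext_minus) (use 4 in \<open>simp_all add: ext_e ext_sm sm2\<close>)
      then show ?thesis using rel_closed \<open>x \<in> tensor_relators K M N\<close> unfolding kerT_def by blast
    qed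
  qed
  have "submodule K kerT F" 
    apply (intro submodule.intro F.module_axioms)
    unfolding kerT_def
    subgoal by blast
    subgoal for u v by (simp add: ext_add P.M.r_zero)
    subgoal using ext_minus[of "\<zero>\<^bsub>F\<^esub>" "\<zero>\<^bsub>F\<^esub>"] by (simp add: a_minus_def F.M.r_neg)
    subgoal for c v by (simp add: ext_sm P.smult_r_null)
    done
  from F.span_is_subset[OF rk this] show ?thesis by (simp add: tensor_null_def)
qed

lemma lift_coset: assumes "f \<in> carrier F" shows "tensor_lift K M N P \<phi> (W +>\<^bsub>F\<^esub> f) = ext f"
proof -
  have "ext u = ext f" if u: "u \<in> W +>\<^bsub>F\<^esub> f" for u
  proof -
    obtain w where w: "w \<in> W" "u = w \<oplus>\<^bsub>F\<^esub> f" using u unfolding a_r_coset_def' by blast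
    have wk: "w \<in> carrier F" "ext w = \<zero>\<^bsub>P\<^esub>" using W_ker w(1) unfolding kerT_def by blast+
    show ?thesis unfolding w(2) ext_add[OF wk(1) assms] wk(2) by (rule P.M.l_zero[OF ext_cl[OF assms]])
  qed
  note * = this
  have "f \<in> W +>\<^bsub>F\<^esub> f" by (rule q.as.a_rcos_self[OF assms])
  then have "ext ` (W +>\<^bsub>F\<^esub> f) = {ext f}" using * by blast
  then have "the_elem (ext ` (W +>\<^bsub>F\<^esub> f)) = ext f" by (simp only: the_elem_eq)
  then show ?thesis unfolding tensor_lift_def ext_def[abs_def] .
qed

lemma tensor_lift_elt: "a \<in> carrier M \<Longrightarrow> b \<in> carrier N \<Longrightarrow> tensor_lift K M N P \<phi> (tensor_elt K M N a b) = \<phi> a b"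
  by (simp add: te lift_coset ext_e)

lemma tensor_lift_linear: "linear_map K (tensor_space K M N) P (tensor_lift K M N P \<phi>)"
proof -
  interpret Q: vectorspace K "tensor_space K M N" by (rule tensor_vs)
  have "tensor_lift K M N P \<phi> \<in> module_hom K (tensor_space K M N) P"
    unfolding module_hom_def tensor_space_def
    apply (intro CollectI conjI allI impI Pi_I)
    subgoal by (erule q.cosetE, simp add: lift_coset ext_cl)
    subgoal by (elim conjE q.cosetE, simp add: q.coset_add lift_coset ext_add)
    subgoal by (elim conjE, erule q.cosetE, simp add: q.coset_smult lift_coset ext_sm)
    done
  then show ?thesis
    by (intro linear_map.intro mod_hom.intro Q.vectorspace_axioms P.vectorspace_axioms Q.module_axioms P.module_axioms mod_hom_axioms.intro)
qed
end


subsection \<open>Tensor products of maps, triple tensor products\<close>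

definition tensor_map where
  "tensor_map K M N M' N' f g =
     tensor_lift K M N (tensor_space K M' N') (\<lambda>a b. tensor_elt K M' N' (f a) (g b))"

text \<open>Triple tensor products are bracketed to the left.
  \<open>tensor_lift3\<close> extends a trilinear map, and \<open>tensor_assoc\<close> is the canonical map
  sending \<open>(a \<otimes> b) \<otimes> c\<close> to \<open>a \<otimes> (b \<otimes> c)\<close>.\<close>

definition tensor_space3 where
  "tensor_space3 K L M N = tensor_space K (tensor_space K L M) N"

definition tensor_elt3 where
  "tensor_elt3 K L M N a b c = tensor_elt K (tensor_space K L M) N (tensor_elt K L M a b) c"

definition tensor_lift3 where
  "tensor_lift3 K L M N P \<phi> =
     tensor_lift K (tensor_space K L M) N P (\<lambda>t c. tensor_lift K L M P (\<lambda>a b. \<phi> a b c) t)"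

definition tensor_assoc where
  "tensor_assoc K L M N =
     tensor_lift3 K L M N (tensor_space K L (tensor_space K M N))
       (\<lambda>a b c. tensor_elt K L (tensor_space K M N) a (tensor_elt K M N b c))"


section \<open>BiHom-associative algebras\<close>

locale bihom_associative_algebra = vectorspace K A
  for K :: "('k, 'm) ring_scheme" and A :: "('k, 'v, 'n) module_scheme" (structure) +
  fixes \<mu> :: "('v \<times> 'v \<Rightarrow> 'k) set \<Rightarrow> 'v"
    and \<alpha> \<beta> :: "'v \<Rightarrow> 'v"
  assumes mu_linear: "linear_map K (tensor_space K A A) A \<mu>"
    and alpha_linear: "linear_map K A A \<alpha>"
    and beta_linear: "linear_map K A A \<beta>"
    and alpha_beta: "x \<in> carrier A \<Longrightarrow> \<alpha> (\<beta> x) = \<beta> (\<alpha> x)"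
    and alpha_mult: "\<lbrakk>x \<in> carrier A; y \<in> carrier A\<rbrakk> \<Longrightarrow>
      \<alpha> (\<mu> (tensor_elt K A A x y)) = \<mu> (tensor_elt K A A (\<alpha> x) (\<alpha> y))"
    and beta_mult: "\<lbrakk>x \<in> carrier A; y \<in> carrier A\<rbrakk> \<Longrightarrow>
      \<beta> (\<mu> (tensor_elt K A A x y)) = \<mu> (tensor_elt K A A (\<beta> x) (\<beta> y))"
    and bihom_assoc: "\<lbrakk>x \<in> carrier A; y \<in> carrier A; z \<in> carrier A\<rbrakk> \<Longrightarrow>
      \<mu> (tensor_elt K A A (\<alpha> x) (\<mu> (tensor_elt K A A y z))) =
      \<mu> (tensor_elt K A A (\<mu> (tensor_elt K A A x y)) (\<beta> z))"

locale rota_baxter_operator = linear_map K A A R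
  for K :: "('k, 'm) ring_scheme" and A :: "('k, 'v, 'n) module_scheme" (structure)
    and R +
  fixes \<mu> :: "('v \<times> 'v \<Rightarrow> 'k) set \<Rightarrow> 'v"
    and w :: 'k
  assumes mu_linear: "linear_map K (tensor_space K A A) A \<mu>"
    and weight_closed: "w \<in> carrier K"
    and rota_baxter: "\<lbrakk>x \<in> carrier A; y \<in> carrier A\<rbrakk> \<Longrightarrow>
      \<mu> (tensor_elt K A A (R x) (R y)) =
      R (\<mu> (tensor_elt K A A (R x) y) \<oplus> \<mu> (tensor_elt K A A x (R y))
         \<oplus> w \<odot> \<mu> (tensor_elt K A A x y))"

locale weak_bihom_pseudotwistor = bihom_associative_algebra K A \<mu> \<alpha> \<beta>
  for K :: "('k, 'm) ring_scheme" and A :: "('k, 'v, 'n) module_scheme" (structure)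
    and \<mu> and \<alpha> and \<beta> +
  fixes T :: "('v \<times> 'v \<Rightarrow> 'k) set \<Rightarrow> ('v \<times> 'v \<Rightarrow> 'k) set"
    and \<T> :: "(('v \<times> 'v \<Rightarrow> 'k) set \<times> 'v \<Rightarrow> 'k) set \<Rightarrow> (('v \<times> 'v \<Rightarrow> 'k) set \<times> 'v \<Rightarrow> 'k) set"
  assumes T_linear: "linear_map K (tensor_space K A A) (tensor_space K A A) T"
    and companion_linear: "linear_map K (tensor_space3 K A A A) (tensor_space3 K A A A) \<T>"
    and T_alpha: "t \<in> carrier (tensor_space K A A) \<Longrightarrow>
      T (tensor_map K A A A A \<alpha> \<alpha> t) = tensor_map K A A A A \<alpha> \<alpha> (T t)"
    and T_beta: "t \<in> carrier (tensor_space K A A) \<Longrightarrow>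
      T (tensor_map K A A A A \<beta> \<beta> t) = tensor_map K A A A A \<beta> \<beta> (T t)"
    and companion_left: "u \<in> carrier (tensor_space3 K A A A) \<Longrightarrow>
      T (tensor_map K A (tensor_space K A A) A A \<alpha> (\<mu> \<circ> T) (tensor_assoc K A A A u)) =
      tensor_map K A (tensor_space K A A) A A \<alpha> \<mu> (tensor_assoc K A A A (\<T> u))"
    and companion_right: "u \<in> carrier (tensor_space3 K A A A) \<Longrightarrow>
      T (tensor_map K (tensor_space K A A) A A A (\<mu> \<circ> T) \<beta> u) =
      tensor_map K (tensor_space K A A) A A A \<mu> \<beta> (\<T> u)"

definition rota_baxter_twistor where
  "rota_baxter_twistor K A R w =
    (let E = tensor_space K A A; e = tensor_elt K A A
     in tensor_lift K A A E
          (\<lambda>a b. e (R a) b \<oplus>\<^bsub>E\<^esub> e a (R b) \<oplus>\<^bsub>E\<^esub> w \<odot>\<^bsub>E\<^esub> e a b))"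

definition rota_baxter_companion where
  "rota_baxter_companion K A R w =
    (let E = tensor_space3 K A A A; e = tensor_elt3 K A A A
     in tensor_lift3 K A A A E
          (\<lambda>a b c. e (R a) (R b) c \<oplus>\<^bsub>E\<^esub> e (R a) b (R c) \<oplus>\<^bsub>E\<^esub> e a (R b) (R c)
             \<oplus>\<^bsub>E\<^esub> w \<odot>\<^bsub>E\<^esub> e (R a) b c \<oplus>\<^bsub>E\<^esub> w \<odot>\<^bsub>E\<^esub> e a (R b) c \<oplus>\<^bsub>E\<^esub> w \<odot>\<^bsub>E\<^esub> e a b (R c)
             \<oplus>\<^bsub>E\<^esub> (w \<otimes>\<^bsub>K\<^esub> w) \<odot>\<^bsub>E\<^esub> e a b c))"

end

theory Submission
  imports Defs
begin

text \<open>
  Write \<open>a * b = \<mu> (T (a \<otimes> b)) = R(a) b + a R(b) + w a b\<close>. The Rota-Baxter identity says exactly that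
  \<open>R (a * b) = R(a) R(b)\<close>. Since \<open>R\<close> commutes with \<open>\<alpha>\<close>, this gives
  \<open>T (\<alpha>(a) \<otimes> b * c) = \<alpha>(R a) \<otimes> b * c + \<alpha>(a) \<otimes> R(b) R(c) + w \<alpha>(a) \<otimes> b * c\<close>,
  and expanding \<open>b * c\<close> in the outer summands yields seven terms, which are the images under
  \<open>\<alpha> \<otimes> \<mu>\<close> of the seven summands of the companion at \<open>a \<otimes> b \<otimes> c\<close>. The identity with \<open>\<beta>\<close> on the
  right arises in the mirrored way (\<open>companion_left_elt\<close>, \<open>companion_right_elt\<close>).

  The new product is then BiHom-associative as for every weak BiHom-pseudotwistor
  (\<open>twisted_bihom_associative\<close>): the companion turns the two bracketings of the new product into the
  two bracketings of the old one, applied to the same tensor.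

  Identities between maps on tensor products are checked on elementary tensors only. This is
  justified by \<open>tensor_linear_ext\<close> and \<open>tensor3_linear_ext\<close>, which express that the elementary
  tensors span. The maps \<open>T\<close> and its companion are linear and have the prescribed values on
  elementary tensors because the defining expressions are bilinear and trilinear: as functions of
  each single argument they are sums of scalar multiples of the slices of \<open>\<otimes>\<close>, some of them
  precomposed with the linear map \<open>R\<close>.
\<close>

section \<open>Linear and bilinear maps\<close>

lemma linear_mapI:
  assumes "vectorspace K V" "vectorspace K W"
    and "\<And>v. v \<in> carrier V \<Longrightarrow> f v \<in> carrier W"
    and "\<And>u v. \<lbrakk>u \<in> carrier V; v \<in> carrier V\<rbrakk> \<Longrightarrow> f (u \<oplus>\<^bsub>V\<^esub> v) = f u \<oplus>\<^bsub>W\<^esub> f v"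
    and "\<And>c v. \<lbrakk>c \<in> carrier K; v \<in> carrier V\<rbrakk> \<Longrightarrow> f (c \<odot>\<^bsub>V\<^esub> v) = c \<odot>\<^bsub>W\<^esub> f v"
  shows "linear_map K V W f"
proof -
  interpret V: vectorspace K V by fact
  interpret W: vectorspace K W by fact
  have "f \<in> module_hom K V W" unfolding module_hom_def using assms by auto
  then show ?thesis
    by (intro linear_map.intro mod_hom.intro V.vectorspace_axioms W.vectorspace_axioms
        V.module_axioms W.module_axioms mod_hom_axioms.intro)
qed

lemma linear_map_vs:
  assumes "linear_map K V W f" shows "vectorspace K V" "vectorspace K W"
  using assms by (simp_all add: linear_map_def)

lemma linear_map_comp:
  assumes f: "linear_map K U V f" and g: "linear_map K V W g"
  shows "linear_map K U W (\<lambda>x. g (f x))"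
  by (rule linear_mapI)
    (use linear_map_vs[OF f] linear_map_vs[OF g] in
      \<open>simp_all add: linear_map.T_add[OF f] linear_map.T_add[OF g] linear_map.T_im[OF f]
        linear_map.T_im[OF g] linear_map.T_smult[OF f] linear_map.T_smult[OF g]\<close>)

lemma linear_map_add:
  assumes f: "linear_map K V W f" and g: "linear_map K V W g"
  shows "linear_map K V W (\<lambda>x. f x \<oplus>\<^bsub>W\<^esub> g x)"
proof -
  interpret W: vectorspace K W by (rule linear_map_vs[OF f])
  show ?thesis
    by (rule linear_mapI)
      (simp_all add: linear_map_vs[OF f] linear_map.T_im[OF f] linear_map.T_im[OF g]
        linear_map.T_add[OF f] linear_map.T_add[OF g] linear_map.T_smult[OF f]
        linear_map.T_smult[OF g] W.M.a_ac W.smult_r_distr)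
qed

lemma linear_map_smult:
  assumes f: "linear_map K V W f" and c: "c \<in> carrier K"
  shows "linear_map K V W (\<lambda>x. c \<odot>\<^bsub>W\<^esub> f x)"
proof -
  interpret W: vectorspace K W by (rule linear_map_vs[OF f])
  show ?thesis
    by (rule linear_mapI)
      (use c in \<open>simp_all add: linear_map_vs[OF f] linear_map.T_im[OF f] linear_map.T_add[OF f]
        linear_map.T_smult[OF f] W.smult_r_distr W.smult_assoc1[symmetric] W.R.m_comm\<close>)
qed

lemma bilinear_mapI:
  assumes M: "vectorspace K M" and N: "vectorspace K N" and P: "vectorspace K P"
    and l: "\<And>b. b \<in> carrier N \<Longrightarrow> linear_map K M P (\<lambda>a. \<phi> a b)"
    and r: "\<And>a. a \<in> carrier M \<Longrightarrow> linear_map K N P (\<phi> a)"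
  shows "bilinear_map K M N P \<phi>"
proof -
  interpret M: vectorspace K M by fact
  interpret N: vectorspace K N by fact
  interpret P: vectorspace K P by fact
  show ?thesis
    by unfold_locales
      (simp_all add: linear_map.T_im[OF r] linear_map.T_add[OF r] linear_map.T_smult[OF r]
        linear_map.T_add[OF l] linear_map.T_smult[OF l])
qed

lemma bilinear_map_left:
  assumes "bilinear_map K M N P \<phi>" "b \<in> carrier N"
  shows "linear_map K M P (\<lambda>a. \<phi> a b)"
proof -
  interpret bilinear_map K M N P \<phi> by fact
  show ?thesis
    by (rule linear_mapI)
      (use assms(2) in \<open>simp_all add: M.vectorspace_axioms P.vectorspace_axioms cl add1 sm1\<close>)
qed

lemma bilinear_map_right:
  assumes "bilinear_map K M N P \<phi>" "a \<in> carrier M"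
  shows "linear_map K N P (\<phi> a)"
proof -
  interpret bilinear_map K M N P \<phi> by fact
  show ?thesis
    by (rule linear_mapI)
      (use assms(2) in \<open>simp_all add: N.vectorspace_axioms P.vectorspace_axioms cl add2 sm2\<close>)
qed

section \<open>Elementary tensors span the tensor product\<close>

text \<open>Peeling off one point of the support at a time writes a finitely supported function as a sum
  of multiples of unit functions.\<close>

lemma free_space_induct [consumes 2, case_names zero add unit]:
  assumes K: "field K" and f: "f \<in> carrier (free_space K X)"
    and zero: "Q \<zero>\<^bsub>free_space K X\<^esub>"
    and add: "\<And>f g. \<lbrakk>f \<in> carrier (free_space K X); g \<in> carrier (free_space K X); Q f; Q g\<rbrakk>
      \<Longrightarrow> Q (f \<oplus>\<^bsub>free_space K X\<^esub> g)"
    and unit: "\<And>c x. \<lbrakk>c \<in> carrier K; x \<in> X\<rbrakk> \<Longrightarrow> Q (c \<odot>\<^bsub>free_space K X\<^esub> free_unit K X x)"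
  shows "Q f"
proof -
  interpret K: field K by fact
  interpret F: vectorspace K "free_space K X" by (rule free_space_vectorspace) fact
  note simps = free_space_simps[OF K]
  have "Q f" if "finite S" "f \<in> carrier (free_space K X)" "\<And>x. x \<in> X - S \<Longrightarrow> f x = \<zero>\<^bsub>K\<^esub>" for S f
    using that
  proof (induction S arbitrary: f)
    case empty
    then have "f = \<zero>\<^bsub>free_space K X\<^esub>" by (auto simp: simps PiE_def extensional_def fun_eq_iff)
    then show ?case using zero by simp
  next
    case (insert x S)
    show ?case
    proof (cases "x \<in> X")
      case False
      then show ?thesis using insert.prems by (intro insert.IH) auto
    next
      case x: True
      \<comment> \<open>\<open>g\<close> is \<open>f\<close> with its value at \<open>x\<close> erased, so that \<open>f\<close> is \<open>g\<close> plus a multiple of the unit at \<open>x\<close>.\<close>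
      define g where "g = (\<lambda>v\<in>X. if v = x then \<zero>\<^bsub>K\<^esub> else f v)"
      have f: "f \<in> X \<rightarrow>\<^sub>E carrier K" "finite {y \<in> X. f y \<noteq> \<zero>\<^bsub>K\<^esub>}"
        using insert.prems(1) by (simp_all add: simps)
      have "finite {y \<in> X. g y \<noteq> \<zero>\<^bsub>K\<^esub>}"
        by (rule finite_subset[OF _ f(2)]) (auto simp: g_def)
      moreover have "g \<in> X \<rightarrow>\<^sub>E carrier K" using f(1) by (auto simp: g_def)
      ultimately have g: "g \<in> carrier (free_space K X)" by (simp add: simps)
      have "Q g" using insert.prems by (intro insert.IH g) (auto simp: g_def)
      moreover have fx: "f x \<in> carrier K" using f x by blast
      ultimately have "Q (g \<oplus>\<^bsub>free_space K X\<^esub> f x \<odot>\<^bsub>free_space K X\<^esub> free_unit K X x)"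
        using x g by (intro add unit F.smult_closed free_unit_closed K)
      moreover have "g \<oplus>\<^bsub>free_space K X\<^esub> f x \<odot>\<^bsub>free_space K X\<^esub> free_unit K X x = f"
      proof
        fix v
        show "(g \<oplus>\<^bsub>free_space K X\<^esub> f x \<odot>\<^bsub>free_space K X\<^esub> free_unit K X x) v = f v"
        proof (cases "v \<in> X")
          case True
          then have "f v \<in> carrier K" using f(1) by blast
          then show ?thesis using True fx by (simp add: simps g_def free_unit_def)
        next
          case False
          then show ?thesis using PiE_arb[OF f(1)] by (simp add: simps)
        qed
      qed
      ultimately show ?thesis by simp
    qed
  qed
  moreover have "finite {x \<in> X. f x \<noteq> \<zero>\<^bsub>K\<^esub>}" using f by (simp add: simps)
  ultimately show ?thesis using f by blast
qed

context vectorspace_pair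
begin

lemma coset_relator_eq:
  assumes u: "u \<in> carrier F" and v: "v \<in> carrier F" and r: "u \<ominus>\<^bsub>F\<^esub> v \<in> tensor_relators K M N"
  shows "W +>\<^bsub>F\<^esub> u = W +>\<^bsub>F\<^esub> v"
proof (rule q.coset_eqI)
  have "u \<ominus>\<^bsub>F\<^esub> v \<in> W"
    unfolding tensor_null_def using F.in_own_span[OF rel_closed] r by blast
  moreover have "u = (u \<ominus>\<^bsub>F\<^esub> v) \<oplus>\<^bsub>F\<^esub> v"
    using u v by (simp add: a_minus_def F.M.a_assoc F.M.l_neg)
  ultimately show "u \<in> W +>\<^bsub>F\<^esub> v" unfolding a_r_coset_def' by blast
qed fact

text \<open>Each of the four families of relators makes one of the four bilinearity equations hold modulo
  \<^term>\<open>tensor_null K M N\<close>.\<close>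

lemma tensor_elt_bilinear: "bilinear_map K M N (tensor_space K M N) (tensor_elt K M N)"
proof -
  interpret Q: vectorspace K "tensor_space K M N" by (rule tensor_vs)
  show ?thesis
  proof
    fix a a' b assume *: "a \<in> carrier M" "a' \<in> carrier M" "b \<in> carrier N"
    have "W +>\<^bsub>F\<^esub> e (a \<oplus>\<^bsub>M\<^esub> a', b) = W +>\<^bsub>F\<^esub> (e (a, b) \<oplus>\<^bsub>F\<^esub> e (a', b))"
      by (rule coset_relator_eq) (use * in \<open>simp, simp, unfold tensor_relators_def Let_def, blast\<close>)
    then show "tensor_elt K M N (a \<oplus>\<^bsub>M\<^esub> a') b
        = tensor_elt K M N a b \<oplus>\<^bsub>tensor_space K M N\<^esub> tensor_elt K M N a' b"
      using * by (simp add: te tensor_space_def q.coset_add)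
  next
    fix a b b' assume *: "a \<in> carrier M" "b \<in> carrier N" "b' \<in> carrier N"
    have "W +>\<^bsub>F\<^esub> e (a, b \<oplus>\<^bsub>N\<^esub> b') = W +>\<^bsub>F\<^esub> (e (a, b) \<oplus>\<^bsub>F\<^esub> e (a, b'))"
      by (rule coset_relator_eq) (use * in \<open>simp, simp, unfold tensor_relators_def Let_def, blast\<close>)
    then show "tensor_elt K M N a (b \<oplus>\<^bsub>N\<^esub> b')
        = tensor_elt K M N a b \<oplus>\<^bsub>tensor_space K M N\<^esub> tensor_elt K M N a b'"
      using * by (simp add: te tensor_space_def q.coset_add)
  next
    fix c a b assume *: "c \<in> carrier K" "a \<in> carrier M" "b \<in> carrier N"
    have "W +>\<^bsub>F\<^esub> e (c \<odot>\<^bsub>M\<^esub> a, b) = W +>\<^bsub>F\<^esub> (c \<odot>\<^bsub>F\<^esub> e (a, b))"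
      by (rule coset_relator_eq) (use * in \<open>simp, simp, unfold tensor_relators_def Let_def, blast\<close>)
    then show "tensor_elt K M N (c \<odot>\<^bsub>M\<^esub> a) b = c \<odot>\<^bsub>tensor_space K M N\<^esub> tensor_elt K M N a b"
      using * by (simp add: te tensor_space_def q.coset_smult)
    have "W +>\<^bsub>F\<^esub> e (a, c \<odot>\<^bsub>N\<^esub> b) = W +>\<^bsub>F\<^esub> (c \<odot>\<^bsub>F\<^esub> e (a, b))"
      by (rule coset_relator_eq) (use * in \<open>simp, simp, unfold tensor_relators_def Let_def, blast\<close>)
    then show "tensor_elt K M N a (c \<odot>\<^bsub>N\<^esub> b) = c \<odot>\<^bsub>tensor_space K M N\<^esub> tensor_elt K M N a b"
      using * by (simp add: te tensor_space_def q.coset_smult)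
  qed (rule te_closed)
qed

text \<open>Every element of the tensor product is the coset of a finitely supported function, and the coset
  of a unit function is an elementary tensor; so the agreement spreads from elementary tensors
  along \<open>free_space_induct\<close>.\<close>

lemma tensor_linear_ext:
  assumes f: "linear_map K (tensor_space K M N) P f" and g: "linear_map K (tensor_space K M N) P g"
    and eq: "\<And>a b. \<lbrakk>a \<in> carrier M; b \<in> carrier N\<rbrakk> \<Longrightarrow> f (tensor_elt K M N a b) = g (tensor_elt K M N a b)"
    and t: "t \<in> carrier (tensor_space K M N)"
  shows "f t = g t"
proof -
  interpret f: linear_map K "tensor_space K M N" P f by fact
  interpret g: linear_map K "tensor_space K M N" P g by fact
  have cl: "W +>\<^bsub>F\<^esub> v \<in> carrier (tensor_space K M N)" if "v \<in> carrier F" for v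
    using q.coset_closed[OF that] by (simp add: tensor_space_def)
  have "f (W +>\<^bsub>F\<^esub> v) = g (W +>\<^bsub>F\<^esub> v)" if "v \<in> carrier F" for v
    using fld that
  proof (induction v rule: free_space_induct)
    case zero
    have "W +>\<^bsub>F\<^esub> \<zero>\<^bsub>F\<^esub> = \<zero>\<^bsub>tensor_space K M N\<^esub>"
      by (simp add: q.coset_zero tensor_space_def)
    then show ?case by simp
  next
    case (add u v)
    then have "W +>\<^bsub>F\<^esub> (u \<oplus>\<^bsub>F\<^esub> v) = (W +>\<^bsub>F\<^esub> u) \<oplus>\<^bsub>tensor_space K M N\<^esub> (W +>\<^bsub>F\<^esub> v)"
      by (simp add: q.coset_add tensor_space_def)
    then show ?case using add cl by simp
  next
    case (unit c x)
    obtain a b where x: "x = (a, b)" "a \<in> carrier M" "b \<in> carrier N" using unit by blast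
    have "W +>\<^bsub>F\<^esub> (c \<odot>\<^bsub>F\<^esub> e x) = c \<odot>\<^bsub>tensor_space K M N\<^esub> tensor_elt K M N a b"
      using x unit by (simp add: q.coset_smult tensor_space_def te)
    then show ?case using x unit te_closed by (simp add: eq)
  qed
  moreover obtain v where "v \<in> carrier F" "t = W +>\<^bsub>F\<^esub> v"
    using t q.cosetE unfolding tensor_space_def by blast
  ultimately show ?thesis by blast
qed

end

section \<open>Tensor products of maps and triple tensor products\<close>

lemma tensor_map_bilinear:
  assumes f: "linear_map K M M' f" and g: "linear_map K N N' g"
  shows "bilinear_map K M N (tensor_space K M' N') (\<lambda>a b. tensor_elt K M' N' (f a) (g b))"
proof -
  interpret f: linear_map K M M' f by fact
  interpret g: linear_map K N N' g by fact
  interpret MN': vectorspace_pair K M' N'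
    by (intro vectorspace_pair.intro f.W.vectorspace_axioms g.W.vectorspace_axioms)
  note b = MN'.tensor_elt_bilinear
  show ?thesis
  proof (rule bilinear_mapI[OF f.V.vectorspace_axioms g.V.vectorspace_axioms MN'.tensor_vs])
    show "linear_map K M (tensor_space K M' N') (\<lambda>a. tensor_elt K M' N' (f a) (g y))"
      if "y \<in> carrier N" for y
      using that by (intro linear_map_comp[OF f bilinear_map_left[OF b]]) simp
    show "linear_map K N (tensor_space K M' N') (\<lambda>b. tensor_elt K M' N' (f x) (g b))"
      if "x \<in> carrier M" for x
      using that by (intro linear_map_comp[OF g bilinear_map_right[OF b]]) simp
  qed
qed

lemma
  assumes f: "linear_map K M M' f" and g: "linear_map K N N' g"
  shows tensor_map_linear:
      "linear_map K (tensor_space K M N) (tensor_space K M' N') (tensor_map K M N M' N' f g)"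
    and tensor_map_elt: "\<lbrakk>a \<in> carrier M; b \<in> carrier N\<rbrakk> \<Longrightarrow>
      tensor_map K M N M' N' f g (tensor_elt K M N a b) = tensor_elt K M' N' (f a) (g b)"
  unfolding tensor_map_def
  by (rule bilinear_map.tensor_lift_linear[OF tensor_map_bilinear[OF f g]],
      rule bilinear_map.tensor_lift_elt[OF tensor_map_bilinear[OF f g]])

locale vectorspace_triple =
  L: vectorspace K L + M: vectorspace K M + N: vectorspace K N for K and L and M and N
begin

sublocale LM: vectorspace_pair K L M ..
sublocale MN: vectorspace_pair K M N ..
sublocale LM_sp: vectorspace K "tensor_space K L M" by (rule LM.tensor_vs)
sublocale MN_sp: vectorspace K "tensor_space K M N" by (rule MN.tensor_vs)
sublocale LM_N: vectorspace_pair K "tensor_space K L M" N ..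
sublocale L_MN: vectorspace_pair K L "tensor_space K M N" ..

lemma tensor3_vs: "vectorspace K (tensor_space3 K L M N)"
  unfolding tensor_space3_def by (rule LM_N.tensor_vs)

lemma tensor_elt3_closed:
  "\<lbrakk>a \<in> carrier L; b \<in> carrier M; c \<in> carrier N\<rbrakk> \<Longrightarrow>
    tensor_elt3 K L M N a b c \<in> carrier (tensor_space3 K L M N)"
  unfolding tensor_elt3_def tensor_space3_def by (intro LM_N.te_closed LM.te_closed)

text \<open>For a fixed third factor both maps become linear on the first tensor product, where elementary
  tensors decide; elementary tensors over that product then decide in the triple product.\<close>

lemma tensor3_linear_ext:
  assumes f: "linear_map K (tensor_space3 K L M N) P f"
    and g: "linear_map K (tensor_space3 K L M N) P g"
    and eq: "\<And>a b c. \<lbrakk>a \<in> carrier L; b \<in> carrier M; c \<in> carrier N\<rbrakk> \<Longrightarrow>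
      f (tensor_elt3 K L M N a b c) = g (tensor_elt3 K L M N a b c)"
    and u: "u \<in> carrier (tensor_space3 K L M N)"
  shows "f u = g u"
proof (rule LM_N.tensor_linear_ext[OF f[unfolded tensor_space3_def] g[unfolded tensor_space3_def] _
      u[unfolded tensor_space3_def]])
  fix t c assume t: "t \<in> carrier (tensor_space K L M)" and c: "c \<in> carrier N"
  note ins = bilinear_map_left[OF LM_N.tensor_elt_bilinear c]
  show "f (tensor_elt K (tensor_space K L M) N t c) = g (tensor_elt K (tensor_space K L M) N t c)"
    by (rule LM.tensor_linear_ext[OF linear_map_comp[OF ins f[unfolded tensor_space3_def]]
          linear_map_comp[OF ins g[unfolded tensor_space3_def]] _ t])
      (rule eq[unfolded tensor_elt3_def, OF _ _ c])
qed

end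

text \<open>Trilinearity is stated slice by slice, so that it can be derived for a compound expression from
  the closure of linear maps under sums, scalar multiples and composition.\<close>

locale trilinear_map = vectorspace_triple K L M N + P: vectorspace K P for K L M N P +
  fixes \<phi>
  assumes lin1: "\<lbrakk>b \<in> carrier M; c \<in> carrier N\<rbrakk> \<Longrightarrow> linear_map K L P (\<lambda>a. \<phi> a b c)"
    and lin2: "\<lbrakk>a \<in> carrier L; c \<in> carrier N\<rbrakk> \<Longrightarrow> linear_map K M P (\<lambda>b. \<phi> a b c)"
    and lin3: "\<lbrakk>a \<in> carrier L; b \<in> carrier M\<rbrakk> \<Longrightarrow> linear_map K N P (\<lambda>c. \<phi> a b c)"
begin

lemma slice_bilinear: "c \<in> carrier N \<Longrightarrow> bilinear_map K L M P (\<lambda>a b. \<phi> a b c)"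
  by (rule bilinear_mapI[OF L.vectorspace_axioms M.vectorspace_axioms P.vectorspace_axioms lin1 lin2])

lemmas slice_linear = bilinear_map.tensor_lift_linear[OF slice_bilinear]
  and slice_elt = bilinear_map.tensor_lift_elt[OF slice_bilinear]

text \<open>Linearity in \<open>c\<close> for a fixed tensor \<open>t\<close> is not visible from the definition of the lift, but it
  compares two linear maps in \<open>t\<close>, hence may be tested on elementary tensors, where it is
  linearity of \<open>\<phi>\<close> in its third argument.\<close>

lemma curried_bilinear:
  "bilinear_map K (tensor_space K L M) N P (\<lambda>t c. tensor_lift K L M P (\<lambda>a b. \<phi> a b c) t)"
proof (rule bilinear_mapI[OF LM.tensor_vs N.vectorspace_axioms P.vectorspace_axioms])
  show "linear_map K (tensor_space K L M) P (tensor_lift K L M P (\<lambda>a b. \<phi> a b c))"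
    if "c \<in> carrier N" for c using that by (rule slice_linear)
  fix t assume t: "t \<in> carrier (tensor_space K L M)"
  show "linear_map K N P (\<lambda>c. tensor_lift K L M P (\<lambda>a b. \<phi> a b c) t)"
  proof (rule linear_mapI[OF N.vectorspace_axioms P.vectorspace_axioms])
    show "tensor_lift K L M P (\<lambda>a b. \<phi> a b c) t \<in> carrier P" if "c \<in> carrier N" for c
      using linear_map.T_im[OF slice_linear[OF that] t] .
    show "tensor_lift K L M P (\<lambda>a b. \<phi> a b (c \<oplus>\<^bsub>N\<^esub> c')) t =
        tensor_lift K L M P (\<lambda>a b. \<phi> a b c) t \<oplus>\<^bsub>P\<^esub> tensor_lift K L M P (\<lambda>a b. \<phi> a b c') t"
      if c: "c \<in> carrier N" "c' \<in> carrier N" for c c'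
      by (rule LM.tensor_linear_ext[OF slice_linear linear_map_add[OF slice_linear slice_linear] _ t])
        (use c in \<open>simp_all add: slice_elt linear_map.T_add[OF lin3]\<close>)
    show "tensor_lift K L M P (\<lambda>a b. \<phi> a b (s \<odot>\<^bsub>N\<^esub> c)) t =
        s \<odot>\<^bsub>P\<^esub> tensor_lift K L M P (\<lambda>a b. \<phi> a b c) t"
      if c: "s \<in> carrier K" "c \<in> carrier N" for s c
      by (rule LM.tensor_linear_ext[OF slice_linear linear_map_smult[OF slice_linear] _ t])
        (use c in \<open>simp_all add: slice_elt linear_map.T_smult[OF lin3]\<close>)
  qed
qed

lemma tensor_lift3_linear: "linear_map K (tensor_space3 K L M N) P (tensor_lift3 K L M N P \<phi>)"
  unfolding tensor_lift3_def tensor_space3_def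
  by (rule bilinear_map.tensor_lift_linear[OF curried_bilinear])

lemma tensor_lift3_elt:
  "\<lbrakk>a \<in> carrier L; b \<in> carrier M; c \<in> carrier N\<rbrakk> \<Longrightarrow>
    tensor_lift3 K L M N P \<phi> (tensor_elt3 K L M N a b c) = \<phi> a b c"
  unfolding tensor_lift3_def tensor_elt3_def
  by (simp add: bilinear_map.tensor_lift_elt[OF curried_bilinear] LM.te_closed slice_elt)

end

context vectorspace_triple
begin

lemma tensor_elt3_trilinear: "trilinear_map K L M N (tensor_space3 K L M N) (tensor_elt3 K L M N)"
proof -
  interpret E: vectorspace K "tensor_space3 K L M N" by (rule tensor3_vs)
  note B = LM_N.tensor_elt_bilinear
  show ?thesis
  proof (rule trilinear_map.intro[OF vectorspace_triple_axioms E.vectorspace_axioms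
        trilinear_map_axioms.intro])
    show "linear_map K L (tensor_space3 K L M N) (\<lambda>a. tensor_elt3 K L M N a b c)"
      if "b \<in> carrier M" "c \<in> carrier N" for b c
      unfolding tensor_elt3_def tensor_space3_def
      by (rule linear_map_comp[OF bilinear_map_left[OF LM.tensor_elt_bilinear that(1)]
            bilinear_map_left[OF B that(2)]])
    show "linear_map K M (tensor_space3 K L M N) (\<lambda>b. tensor_elt3 K L M N a b c)"
      if "a \<in> carrier L" "c \<in> carrier N" for a c
      unfolding tensor_elt3_def tensor_space3_def
      by (rule linear_map_comp[OF bilinear_map_right[OF LM.tensor_elt_bilinear that(1)]
            bilinear_map_left[OF B that(2)]])
    show "linear_map K N (tensor_space3 K L M N) (\<lambda>c. tensor_elt3 K L M N a b c)"
      if "a \<in> carrier L" "b \<in> carrier M" for a b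
      unfolding tensor_elt3_def tensor_space3_def
      by (rule bilinear_map_right[OF B LM.te_closed[OF that]])
  qed
qed

lemma tensor_assoc_trilinear:
  "trilinear_map K L M N (tensor_space K L (tensor_space K M N))
     (\<lambda>a b c. tensor_elt K L (tensor_space K M N) a (tensor_elt K M N b c))"
proof -
  interpret E: vectorspace K "tensor_space K L (tensor_space K M N)" by (rule L_MN.tensor_vs)
  note B = L_MN.tensor_elt_bilinear
  show ?thesis
  proof (rule trilinear_map.intro[OF vectorspace_triple_axioms E.vectorspace_axioms
        trilinear_map_axioms.intro])
    show "linear_map K L (tensor_space K L (tensor_space K M N))
        (\<lambda>a. tensor_elt K L (tensor_space K M N) a (tensor_elt K M N b c))"
      if "b \<in> carrier M" "c \<in> carrier N" for b c
      by (rule bilinear_map_left[OF B MN.te_closed[OF that]])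
    show "linear_map K M (tensor_space K L (tensor_space K M N))
        (\<lambda>b. tensor_elt K L (tensor_space K M N) a (tensor_elt K M N b c))"
      if "a \<in> carrier L" "c \<in> carrier N" for a c
      by (rule linear_map_comp[OF bilinear_map_left[OF MN.tensor_elt_bilinear that(2)]
            bilinear_map_right[OF B that(1)]])
    show "linear_map K N (tensor_space K L (tensor_space K M N))
        (\<lambda>c. tensor_elt K L (tensor_space K M N) a (tensor_elt K M N b c))"
      if "a \<in> carrier L" "b \<in> carrier M" for a b
      by (rule linear_map_comp[OF bilinear_map_right[OF MN.tensor_elt_bilinear that(2)]
            bilinear_map_right[OF B that(1)]])
  qed
qed

lemmas tensor_assoc_linear =
    trilinear_map.tensor_lift3_linear[OF tensor_assoc_trilinear, folded tensor_assoc_def]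
  and tensor_assoc_elt =
    trilinear_map.tensor_lift3_elt[OF tensor_assoc_trilinear, folded tensor_assoc_def]

end

section \<open>The algebra twisted by a weak pseudotwistor\<close>

text \<open>With \<open>u = x \<otimes> y \<otimes> z\<close>, the two bracketings of the new product are
  \<open>\<mu> \<circ> T \<circ> (\<alpha> \<otimes> (\<mu> \<circ> T))\<close> and \<open>\<mu> \<circ> T \<circ> ((\<mu> \<circ> T) \<otimes> \<beta>)\<close> at \<open>u\<close>, up to rebracketing. The companion rewrites them to
  \<open>\<mu> \<circ> (\<alpha> \<otimes> \<mu>)\<close> and \<open>\<mu> \<circ> (\<mu> \<otimes> \<beta>)\<close> at \<open>\<T> u\<close>, and these agree on all tensors by the
  BiHom-associativity of \<open>\<mu>\<close>. Multiplicativity of \<open>\<alpha>\<close> and \<open>\<beta>\<close> is inherited since \<open>T\<close> commutes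
  with \<open>\<alpha> \<otimes> \<alpha>\<close> and \<open>\<beta> \<otimes> \<beta>\<close>.\<close>

lemma (in weak_bihom_pseudotwistor) twisted_bihom_associative:
  "bihom_associative_algebra K A (\<mu> \<circ> T) \<alpha> \<beta>"
proof -
  interpret vectorspace_triple K A A A ..
  let ?E = "tensor_space K A A"
  let ?e = "tensor_elt K A A"
  have \<mu>T: "linear_map K ?E A (\<mu> \<circ> T)"
    using linear_map_comp[OF T_linear mu_linear] by (simp add: comp_def)
  note elt = LM.te_closed
  have T_cl: "T t \<in> carrier ?E" if "t \<in> carrier ?E" for t
    using linear_map.T_im[OF T_linear that] .
  note \<alpha>\<alpha> = tensor_map_linear[OF alpha_linear alpha_linear]
    and \<beta>\<beta> = tensor_map_linear[OF beta_linear beta_linear]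
    and \<alpha>\<mu> = tensor_map_linear[OF alpha_linear mu_linear]
    and \<mu>\<beta> = tensor_map_linear[OF mu_linear beta_linear]
  \<comment> \<open>\<open>T (x \<otimes> y)\<close> need not be an elementary tensor, so multiplicativity of \<open>\<alpha>\<close> and \<open>\<beta>\<close>
    and BiHom-associativity are needed on all tensors.\<close>
  have \<alpha>_\<mu>: "\<alpha> (\<mu> t) = \<mu> (tensor_map K A A A A \<alpha> \<alpha> t)" if "t \<in> carrier ?E" for t
    by (rule LM.tensor_linear_ext[OF linear_map_comp[OF mu_linear alpha_linear]
          linear_map_comp[OF \<alpha>\<alpha> mu_linear] _ that])
      (simp add: alpha_mult tensor_map_elt[OF alpha_linear alpha_linear])
  have \<beta>_\<mu>: "\<beta> (\<mu> t) = \<mu> (tensor_map K A A A A \<beta> \<beta> t)" if "t \<in> carrier ?E" for t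
    by (rule LM.tensor_linear_ext[OF linear_map_comp[OF mu_linear beta_linear]
          linear_map_comp[OF \<beta>\<beta> mu_linear] _ that])
      (simp add: beta_mult tensor_map_elt[OF beta_linear beta_linear])
  have assoc: "\<mu> (tensor_map K A ?E A A \<alpha> \<mu> (tensor_assoc K A A A u)) =
      \<mu> (tensor_map K ?E A A A \<mu> \<beta> u)" if "u \<in> carrier (tensor_space3 K A A A)" for u
  proof (rule tensor3_linear_ext[OF
          linear_map_comp[OF tensor_assoc_linear linear_map_comp[OF \<alpha>\<mu> mu_linear]]
          linear_map_comp[OF \<mu>\<beta>[folded tensor_space3_def] mu_linear] _ that])
    fix a b c assume *: "a \<in> carrier A" "b \<in> carrier A" "c \<in> carrier A"
    then show "\<mu> (tensor_map K A ?E A A \<alpha> \<mu> (tensor_assoc K A A A (tensor_elt3 K A A A a b c))) =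
      \<mu> (tensor_map K ?E A A A \<mu> \<beta> (tensor_elt3 K A A A a b c))"
      by (simp add: tensor_assoc_elt tensor_map_elt[OF alpha_linear mu_linear] elt bihom_assoc)
        (simp add: tensor_elt3_def tensor_map_elt[OF mu_linear beta_linear] elt)
  qed
  show ?thesis
  proof (intro bihom_associative_algebra.intro bihom_associative_algebra_axioms.intro
      vectorspace_axioms \<mu>T alpha_linear beta_linear alpha_beta)
    fix x y assume xy: "x \<in> carrier A" "y \<in> carrier A"
    show "\<alpha> ((\<mu> \<circ> T) (?e x y)) = (\<mu> \<circ> T) (?e (\<alpha> x) (\<alpha> y))"
      using xy by (simp add: \<alpha>_\<mu> T_cl elt T_alpha[symmetric] tensor_map_elt[OF alpha_linear alpha_linear])
    show "\<beta> ((\<mu> \<circ> T) (?e x y)) = (\<mu> \<circ> T) (?e (\<beta> x) (\<beta> y))"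
      using xy by (simp add: \<beta>_\<mu> T_cl elt T_beta[symmetric] tensor_map_elt[OF beta_linear beta_linear])
    fix z assume z: "z \<in> carrier A"
    define u where "u = tensor_elt3 K A A A x y z"
    have u: "u \<in> carrier (tensor_space3 K A A A)"
      using xy z unfolding u_def by (intro tensor_elt3_closed)
    have Tu: "\<T> u \<in> carrier (tensor_space3 K A A A)"
      using linear_map.T_im[OF companion_linear u] .
    have "(\<mu> \<circ> T) (?e (\<alpha> x) ((\<mu> \<circ> T) (?e y z))) =
        \<mu> (T (tensor_map K A ?E A A \<alpha> (\<mu> \<circ> T) (tensor_assoc K A A A u)))"
      using xy z by (simp add: u_def tensor_assoc_elt tensor_map_elt[OF alpha_linear \<mu>T] elt)
    also have "\<dots> = \<mu> (tensor_map K ?E A A A \<mu> \<beta> (\<T> u))"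
      by (simp add: companion_left[OF u] assoc[OF Tu])
    also have "\<dots> = \<mu> (T (tensor_map K ?E A A A (\<mu> \<circ> T) \<beta> u))"
      by (simp add: companion_right[OF u])
    also have "\<dots> = (\<mu> \<circ> T) (?e ((\<mu> \<circ> T) (?e x y)) (\<beta> z))"
      using xy z by (simp add: u_def tensor_elt3_def tensor_map_elt[OF \<mu>T beta_linear] elt)
    finally show "(\<mu> \<circ> T) (?e (\<alpha> x) ((\<mu> \<circ> T) (?e y z))) =
        (\<mu> \<circ> T) (?e ((\<mu> \<circ> T) (?e x y)) (\<beta> z))" .
  qed
qed

section \<open>The pseudotwistor of a Rota-Baxter operator\<close>

locale rota_baxter_bihom = bihom_associative_algebra K A \<mu> \<alpha> \<beta> + RB: rota_baxter_operator K A R \<mu> w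
  for K :: "('k, 'm) ring_scheme" and A :: "('k, 'v, 'n) module_scheme" (structure)
    and \<mu> and \<alpha> and \<beta> and R and w +
  assumes R_alpha: "x \<in> carrier A \<Longrightarrow> R (\<alpha> x) = \<alpha> (R x)"
    and R_beta: "x \<in> carrier A \<Longrightarrow> R (\<beta> x) = \<beta> (R x)"
begin

sublocale triple: vectorspace_triple K A A A ..

abbreviation "E \<equiv> tensor_space K A A"
abbreviation "E3 \<equiv> tensor_space3 K A A A"
abbreviation "e2 \<equiv> tensor_elt K A A"
abbreviation "e3 \<equiv> tensor_elt3 K A A A"
abbreviation "T \<equiv> rota_baxter_twistor K A R w"
abbreviation "\<T> \<equiv> rota_baxter_companion K A R w"

lemma R_linear: "linear_map K A A R" by (rule RB.linear_map_axioms)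

lemmas R_closed = linear_map.T_im[OF R_linear]
lemmas w_closed = RB.weight_closed

lemma e2_bilinear: "bilinear_map K A A E e2" by (rule triple.LM.tensor_elt_bilinear)
lemmas e2_closed = triple.LM.te_closed

lemma twistor_bilinear:
  "bilinear_map K A A E (\<lambda>a b. e2 (R a) b \<oplus>\<^bsub>E\<^esub> e2 a (R b) \<oplus>\<^bsub>E\<^esub> w \<odot>\<^bsub>E\<^esub> e2 a b)"
proof (rule bilinear_mapI[OF vectorspace_axioms vectorspace_axioms triple.LM.tensor_vs])
  note l = bilinear_map_left[OF e2_bilinear] and r = bilinear_map_right[OF e2_bilinear]
  fix a assume a: "a \<in> carrier A"
  show "linear_map K A E (\<lambda>x. e2 (R x) a \<oplus>\<^bsub>E\<^esub> e2 x (R a) \<oplus>\<^bsub>E\<^esub> w \<odot>\<^bsub>E\<^esub> e2 x a)"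
    using a by (intro linear_map_add linear_map_smult l w_closed R_closed linear_map_comp[OF R_linear l])
  show "linear_map K A E (\<lambda>x. e2 (R a) x \<oplus>\<^bsub>E\<^esub> e2 a (R x) \<oplus>\<^bsub>E\<^esub> w \<odot>\<^bsub>E\<^esub> e2 a x)"
    using a by (intro linear_map_add linear_map_smult r w_closed R_closed linear_map_comp[OF R_linear r])
qed

lemma twistor_linear: "linear_map K E E T"
  unfolding rota_baxter_twistor_def Let_def by (rule bilinear_map.tensor_lift_linear[OF twistor_bilinear])

lemma twistor_elt:
  "\<lbrakk>a \<in> carrier A; b \<in> carrier A\<rbrakk> \<Longrightarrow>
    T (e2 a b) = e2 (R a) b \<oplus>\<^bsub>E\<^esub> e2 a (R b) \<oplus>\<^bsub>E\<^esub> w \<odot>\<^bsub>E\<^esub> e2 a b"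
  unfolding rota_baxter_twistor_def Let_def by (rule bilinear_map.tensor_lift_elt[OF twistor_bilinear])

lemma companion_trilinear:
  "trilinear_map K A A A E3 (\<lambda>a b c. e3 (R a) (R b) c \<oplus>\<^bsub>E3\<^esub> e3 (R a) b (R c) \<oplus>\<^bsub>E3\<^esub> e3 a (R b) (R c)
     \<oplus>\<^bsub>E3\<^esub> w \<odot>\<^bsub>E3\<^esub> e3 (R a) b c \<oplus>\<^bsub>E3\<^esub> w \<odot>\<^bsub>E3\<^esub> e3 a (R b) c \<oplus>\<^bsub>E3\<^esub> w \<odot>\<^bsub>E3\<^esub> e3 a b (R c)
     \<oplus>\<^bsub>E3\<^esub> (w \<otimes>\<^bsub>K\<^esub> w) \<odot>\<^bsub>E3\<^esub> e3 a b c)"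
    (is "trilinear_map K A A A E3 ?\<phi>")
proof (intro trilinear_map.intro trilinear_map_axioms.intro triple.vectorspace_triple_axioms triple.tensor3_vs)
  note l1 = trilinear_map.lin1[OF triple.tensor_elt3_trilinear]
    and l2 = trilinear_map.lin2[OF triple.tensor_elt3_trilinear]
    and l3 = trilinear_map.lin3[OF triple.tensor_elt3_trilinear]
  note intros = linear_map_add linear_map_smult w_closed R_closed R.m_closed
  fix a b assume ab: "a \<in> carrier A" "b \<in> carrier A"
  show "linear_map K A E3 (\<lambda>x. ?\<phi> x a b)"
    using ab by (intro intros l1 linear_map_comp[OF R_linear l1])
  show "linear_map K A E3 (\<lambda>x. ?\<phi> a x b)"
    using ab by (intro intros l2 linear_map_comp[OF R_linear l2])
  show "linear_map K A E3 (\<lambda>x. ?\<phi> a b x)"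
    using ab by (intro intros l3 linear_map_comp[OF R_linear l3])
qed

lemma companion_map_linear: "linear_map K E3 E3 \<T>"
  unfolding rota_baxter_companion_def Let_def
  by (rule trilinear_map.tensor_lift3_linear[OF companion_trilinear])

lemma companion_elt:
  "\<lbrakk>a \<in> carrier A; b \<in> carrier A; c \<in> carrier A\<rbrakk> \<Longrightarrow>
    \<T> (e3 a b c) = e3 (R a) (R b) c \<oplus>\<^bsub>E3\<^esub> e3 (R a) b (R c) \<oplus>\<^bsub>E3\<^esub> e3 a (R b) (R c)
     \<oplus>\<^bsub>E3\<^esub> w \<odot>\<^bsub>E3\<^esub> e3 (R a) b c \<oplus>\<^bsub>E3\<^esub> w \<odot>\<^bsub>E3\<^esub> e3 a (R b) c \<oplus>\<^bsub>E3\<^esub> w \<odot>\<^bsub>E3\<^esub> e3 a b (R c)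
     \<oplus>\<^bsub>E3\<^esub> (w \<otimes>\<^bsub>K\<^esub> w) \<odot>\<^bsub>E3\<^esub> e3 a b c"
  unfolding rota_baxter_companion_def Let_def
  by (rule trilinear_map.tensor_lift3_elt[OF companion_trilinear])

lemma twisted_product:
  assumes "a \<in> carrier A" "b \<in> carrier A"
  shows "\<mu> (T (e2 a b)) = \<mu> (e2 (R a) b) \<oplus> \<mu> (e2 a (R b)) \<oplus> w \<odot> \<mu> (e2 a b)"
  using assms by (simp add: twistor_elt e2_closed R_closed w_closed linear_map.T_add[OF mu_linear]
      linear_map.T_smult[OF mu_linear])

text \<open>The Rota-Baxter identity in the form in which the proof uses it: \<open>R\<close> is multiplicative from the
  new product to the old one.\<close>

lemma R_twisted_product:
  assumes "a \<in> carrier A" "b \<in> carrier A"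
  shows "R (\<mu> (T (e2 a b))) = \<mu> (e2 (R a) (R b))"
  using assms by (simp add: twisted_product RB.rota_baxter)

lemma twistor_commutes:
  assumes g: "linear_map K A A g" and Rg: "\<And>x. x \<in> carrier A \<Longrightarrow> R (g x) = g (R x)"
    and t: "t \<in> carrier E"
  shows "T (tensor_map K A A A A g g t) = tensor_map K A A A A g g (T t)"
proof (rule triple.LM.tensor_linear_ext[OF _ _ _ t])
  note gg = tensor_map_linear[OF g g]
  show "linear_map K E E (\<lambda>t. T (tensor_map K A A A A g g t))"
    by (rule linear_map_comp[OF gg twistor_linear])
  show "linear_map K E E (\<lambda>t. tensor_map K A A A A g g (T t))"
    by (rule linear_map_comp[OF twistor_linear gg])
  fix a b assume "a \<in> carrier A" "b \<in> carrier A"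
  then show "T (tensor_map K A A A A g g (e2 a b)) = tensor_map K A A A A g g (T (e2 a b))"
    by (simp add: tensor_map_elt[OF g g] twistor_elt e2_closed R_closed w_closed Rg
        linear_map.T_im[OF g] linear_map.T_add[OF gg] linear_map.T_smult[OF gg])
qed

text \<open>\<open>R_twisted_product\<close> reduces \<open>R\<close> of the inner new product to the old product \<open>R(b) R(c)\<close>; what
  remains is bilinear expansion and comparison of the seven summands.\<close>

lemma companion_left_elt:
  assumes "a \<in> carrier A" "b \<in> carrier A" "c \<in> carrier A"
  shows "T (e2 (\<alpha> a) (\<mu> (T (e2 b c)))) =
    tensor_map K A E A A \<alpha> \<mu> (tensor_assoc K A A A (\<T> (e3 a b c)))"
proof -
  interpret E3: vectorspace K E3 by (rule triple.tensor3_vs)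
  note \<alpha>_cl = linear_map.T_im[OF alpha_linear] and \<mu>_cl = linear_map.T_im[OF mu_linear]
  note F = linear_map_comp[OF triple.tensor_assoc_linear tensor_map_linear[OF alpha_linear mu_linear]]
  let ?F = "\<lambda>u. tensor_map K A E A A \<alpha> \<mu> (tensor_assoc K A A A u)"
  have F_elt: "?F (e3 x y z) = e2 (\<alpha> x) (\<mu> (e2 y z))"
    if "x \<in> carrier A" "y \<in> carrier A" "z \<in> carrier A" for x y z
    using that by (simp add: triple.tensor_assoc_elt tensor_map_elt[OF alpha_linear mu_linear] e2_closed)
  note b = bilinear_map_right[OF e2_bilinear]
  have cl: "\<mu> (T (e2 b c)) \<in> carrier A"
    using assms by (intro \<mu>_cl linear_map.T_im[OF twistor_linear] e2_closed)
  have "T (e2 (\<alpha> a) (\<mu> (T (e2 b c)))) =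
      e2 (\<alpha> (R a)) (\<mu> (T (e2 b c))) \<oplus>\<^bsub>E\<^esub> e2 (\<alpha> a) (\<mu> (e2 (R b) (R c)))
      \<oplus>\<^bsub>E\<^esub> w \<odot>\<^bsub>E\<^esub> e2 (\<alpha> a) (\<mu> (T (e2 b c)))"
    using assms by (simp add: twistor_elt[OF \<alpha>_cl cl] R_alpha R_twisted_product)
  also have "\<dots> = ?F (\<T> (e3 a b c))"
    using assms by (simp add: companion_elt F_elt triple.tensor_elt3_closed linear_map.T_add[OF F] linear_map.T_smult[OF F]
        R_closed w_closed twisted_product \<mu>_cl e2_closed \<alpha>_cl linear_map.T_add[OF b] linear_map.T_smult[OF b]
        triple.LM_sp.smult_r_distr triple.LM_sp.smult_assoc1 triple.LM_sp.M.a_ac)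
  finally show ?thesis .
qed

lemma companion_right_elt:
  assumes "a \<in> carrier A" "b \<in> carrier A" "c \<in> carrier A"
  shows "T (e2 (\<mu> (T (e2 a b))) (\<beta> c)) = tensor_map K E A A A \<mu> \<beta> (\<T> (e3 a b c))"
proof -
  interpret E3: vectorspace K E3 by (rule triple.tensor3_vs)
  note \<beta>_cl = linear_map.T_im[OF beta_linear] and \<mu>_cl = linear_map.T_im[OF mu_linear]
  note F = tensor_map_linear[OF mu_linear beta_linear, folded tensor_space3_def]
  let ?F = "tensor_map K E A A A \<mu> \<beta>"
  have F_elt: "?F (e3 x y z) = e2 (\<mu> (e2 x y)) (\<beta> z)"
    if "x \<in> carrier A" "y \<in> carrier A" "z \<in> carrier A" for x y z
    using that by (simp add: tensor_elt3_def tensor_map_elt[OF mu_linear beta_linear] e2_closed)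
  note l = bilinear_map_left[OF e2_bilinear]
  have cl: "\<mu> (T (e2 a b)) \<in> carrier A"
    using assms by (intro \<mu>_cl linear_map.T_im[OF twistor_linear] e2_closed)
  have "T (e2 (\<mu> (T (e2 a b))) (\<beta> c)) =
      e2 (\<mu> (e2 (R a) (R b))) (\<beta> c) \<oplus>\<^bsub>E\<^esub> e2 (\<mu> (T (e2 a b))) (\<beta> (R c))
      \<oplus>\<^bsub>E\<^esub> w \<odot>\<^bsub>E\<^esub> e2 (\<mu> (T (e2 a b))) (\<beta> c)"
    using assms by (simp add: twistor_elt[OF cl \<beta>_cl] R_beta R_twisted_product)
  also have "\<dots> = ?F (\<T> (e3 a b c))"
    using assms by (simp add: companion_elt F_elt triple.tensor_elt3_closed linear_map.T_add[OF F] linear_map.T_smult[OF F]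
        R_closed w_closed twisted_product \<mu>_cl e2_closed \<beta>_cl linear_map.T_add[OF l] linear_map.T_smult[OF l]
        triple.LM_sp.smult_r_distr triple.LM_sp.smult_assoc1 triple.LM_sp.M.a_ac)
  finally show ?thesis .
qed

lemma rota_baxter_pseudotwistor: "weak_bihom_pseudotwistor K A \<mu> \<alpha> \<beta> T \<T>"
proof (intro weak_bihom_pseudotwistor.intro weak_bihom_pseudotwistor_axioms.intro
    bihom_associative_algebra_axioms twistor_linear companion_map_linear)
  fix t assume t: "t \<in> carrier E"
  show "T (tensor_map K A A A A \<alpha> \<alpha> t) = tensor_map K A A A A \<alpha> \<alpha> (T t)"
    by (rule twistor_commutes[OF alpha_linear R_alpha t])
  show "T (tensor_map K A A A A \<beta> \<beta> t) = tensor_map K A A A A \<beta> \<beta> (T t)"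
    by (rule twistor_commutes[OF beta_linear R_beta t])
next
  have \<mu>T: "linear_map K E A (\<mu> \<circ> T)"
    using linear_map_comp[OF twistor_linear mu_linear] by (simp add: comp_def)
  fix u assume u: "u \<in> carrier E3"
  show "T (tensor_map K A E A A \<alpha> (\<mu> \<circ> T) (tensor_assoc K A A A u)) =
      tensor_map K A E A A \<alpha> \<mu> (tensor_assoc K A A A (\<T> u))"
  proof (rule triple.tensor3_linear_ext[OF _ _ _ u])
    show "linear_map K E3 E (\<lambda>u. T (tensor_map K A E A A \<alpha> (\<mu> \<circ> T) (tensor_assoc K A A A u)))"
      by (intro linear_map_comp[OF triple.tensor_assoc_linear] linear_map_comp[OF _ twistor_linear]
          tensor_map_linear alpha_linear \<mu>T)
    show "linear_map K E3 E (\<lambda>u. tensor_map K A E A A \<alpha> \<mu> (tensor_assoc K A A A (\<T> u)))"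
      by (intro linear_map_comp[OF companion_map_linear] linear_map_comp[OF triple.tensor_assoc_linear]
          tensor_map_linear alpha_linear mu_linear)
    fix a b c assume "a \<in> carrier A" "b \<in> carrier A" "c \<in> carrier A"
    then show "T (tensor_map K A E A A \<alpha> (\<mu> \<circ> T) (tensor_assoc K A A A (e3 a b c))) =
        tensor_map K A E A A \<alpha> \<mu> (tensor_assoc K A A A (\<T> (e3 a b c)))"
      by (simp only: triple.tensor_assoc_elt tensor_map_elt[OF alpha_linear \<mu>T] e2_closed comp_apply
          companion_left_elt)
  qed
  show "T (tensor_map K E A A A (\<mu> \<circ> T) \<beta> u) = tensor_map K E A A A \<mu> \<beta> (\<T> u)"
  proof (rule triple.tensor3_linear_ext[OF _ _ _ u])
    show "linear_map K E3 E (\<lambda>u. T (tensor_map K E A A A (\<mu> \<circ> T) \<beta> u))"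
      unfolding tensor_space3_def
      by (intro linear_map_comp[OF _ twistor_linear] tensor_map_linear beta_linear \<mu>T)
    show "linear_map K E3 E (\<lambda>u. tensor_map K E A A A \<mu> \<beta> (\<T> u))"
      by (rule linear_map_comp[OF companion_map_linear
            tensor_map_linear[OF mu_linear beta_linear, folded tensor_space3_def]])
    fix a b c assume "a \<in> carrier A" "b \<in> carrier A" "c \<in> carrier A"
    then show "T (tensor_map K E A A A (\<mu> \<circ> T) \<beta> (e3 a b c)) =
        tensor_map K E A A A \<mu> \<beta> (\<T> (e3 a b c))"
      by (simp add: companion_right_elt[symmetric])
        (simp add: tensor_elt3_def tensor_map_elt[OF \<mu>T beta_linear] e2_closed)
  qed
qed

end

theorem proposition5p4:
  fixes K :: "('k, 'm) ring_scheme"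
    and A :: "('k, 'a, 'n) module_scheme"
    and \<mu> :: "('a \<times> 'a \<Rightarrow> 'k) set \<Rightarrow> 'a"
    and \<alpha> \<beta> R :: "'a \<Rightarrow> 'a"
    and w :: 'k
  assumes "bihom_associative_algebra K A \<mu> \<alpha> \<beta>"
    and "rota_baxter_operator K A R \<mu> w"
    and "\<And>x. x \<in> carrier A \<Longrightarrow> R (\<alpha> x) = \<alpha> (R x)"
    and "\<And>x. x \<in> carrier A \<Longrightarrow> R (\<beta> x) = \<beta> (R x)"
  shows "let T = rota_baxter_twistor K A R w; \<T> = rota_baxter_companion K A R w;
             E2 = tensor_space K A A; e2 = tensor_elt K A A;
             E3 = tensor_space3 K A A A; e3 = tensor_elt3 K A A A
    in (\<forall>a\<in>carrier A. \<forall>b\<in>carrier A.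
          T (e2 a b) = e2 (R a) b \<oplus>\<^bsub>E2\<^esub> e2 a (R b) \<oplus>\<^bsub>E2\<^esub> w \<odot>\<^bsub>E2\<^esub> e2 a b) \<and>
       (\<forall>a\<in>carrier A. \<forall>b\<in>carrier A. \<forall>c\<in>carrier A.
          \<T> (e3 a b c) =
            e3 (R a) (R b) c \<oplus>\<^bsub>E3\<^esub> e3 (R a) b (R c) \<oplus>\<^bsub>E3\<^esub> e3 a (R b) (R c)
            \<oplus>\<^bsub>E3\<^esub> w \<odot>\<^bsub>E3\<^esub> e3 (R a) b c \<oplus>\<^bsub>E3\<^esub> w \<odot>\<^bsub>E3\<^esub> e3 a (R b) c \<oplus>\<^bsub>E3\<^esub> w \<odot>\<^bsub>E3\<^esub> e3 a b (R c)
            \<oplus>\<^bsub>E3\<^esub> (w \<otimes>\<^bsub>K\<^esub> w) \<odot>\<^bsub>E3\<^esub> e3 a b c) \<and>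
       weak_bihom_pseudotwistor K A \<mu> \<alpha> \<beta> T \<T> \<and>
       bihom_associative_algebra K A (\<mu> \<circ> T) \<alpha> \<beta> \<and>
       (\<forall>a\<in>carrier A. \<forall>b\<in>carrier A.
          (\<mu> \<circ> T) (e2 a b) = \<mu> (e2 (R a) b) \<oplus>\<^bsub>A\<^esub> \<mu> (e2 a (R b)) \<oplus>\<^bsub>A\<^esub> w \<odot>\<^bsub>A\<^esub> \<mu> (e2 a b))"
proof -
  interpret rota_baxter_bihom K A \<mu> \<alpha> \<beta> R w
    using assms by (intro rota_baxter_bihom.intro rota_baxter_bihom_axioms.intro)
  have product: "(\<mu> \<circ> T) (e2 a b) = \<mu> (e2 (R a) b) \<oplus>\<^bsub>A\<^esub> \<mu> (e2 a (R b)) \<oplus>\<^bsub>A\<^esub> w \<odot>\<^bsub>A\<^esub> \<mu> (e2 a b)"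
    if "a \<in> carrier A" "b \<in> carrier A" for a b
    using twisted_product[OF that] by (simp only: comp_apply)
  show ?thesis
    unfolding Let_def
    by (intro conjI ballI twistor_elt companion_elt rota_baxter_pseudotwistor product
        weak_bihom_pseudotwistor.twisted_bihom_associative[OF rota_baxter_pseudotwistor])
qed

end
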